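(* Let $\beta\in(0,\infty)$ and $z_0\in\mathbb C$, and consider $\{Z_t\}$ under $\mathbb P^{(0),\beta\downarrow}_{z_0}$. For every $t_1\in(0,\infty)$, the law of $\{Z_t\}_{t\in[0,t_1]}$ has a nonzero singular part in its Lebesgue decomposition with respect to the law of planar Brownian motion (started at $z_0$) restricted to $[0,t_1]$. Moreover, the law of $\{Z_t\}_{t\in[0,\infty)}$ is singular to the law of planar Brownian motion (started at $z_0$).
   Context: $K_\nu$ is the Macdonald function (modified Bessel function of the second kind). $\mathrm{BES}(0,\beta\downarrow)$ is the diffusion on $[0,\infty)$ with generator $\frac12\frac{d^2}{dx^2}+\big(\frac1{2x}-\sqrt{2\beta}\frac{K_1}{K_0}(\sqrt{2\beta}x)\big)\frac{d}{dx}$ on $(0,\infty)$ and $0$ instantaneously reflecting (scale function $\int_0^x\frac{dy}{yK_0(\sqrt{2\beta}y)^2}$, speed measure $2xK_0(\sqrt{2\beta}x)^2dx$ with no mass at $0$). Under $\mathbb P^{(0),\beta\downarrow}_{z_0}$, $\{Z_t\}$ is the $\mathbb C$-valued continuous strong Markov process with $Z_0=z_0$, unique in law, such that $\{|Z_t|\}$ is a version of $\mathrm{BES}(0,\beta\downarrow)$ and, for every starting point $z_0\neq0$, $Z_t=|Z_t|\exp\{\mathtt i\,\dot\gamma_{\int_0^tds/|Z_s|^2}\}$ for $t<\inf\{t\ge0:Z_t=0\}$, with $\{\dot\gamma_t\}$ a circular Brownian motion (standard one-dimensional Brownian motion mod $2\pi$) independent of $\{|Z_t|\}$. Laws are on the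 space of continuous $\mathbb C$-valued paths. *)

theory Defs
  imports "HOL-Probability.Probability" "HOL-Library.Real_Mod"
begin

section \<open>Continuous paths\<close>

text \<open>
  The space \<open>C(I, E)\<close> with the sigma-algebra generated by the coordinates (for \<open>I = [0,t]\<close> and
  \<open>I = [0,\<infinity>)\<close> this is the Borel sigma-algebra of locally uniform convergence). Paths are extensional:
  their value outside \<open>I\<close> is \<open>undefined\<close>.
\<close>
definition path_space :: "real set \<Rightarrow> 'a::topological_space set \<Rightarrow> (real \<Rightarrow> 'a) measure" where
  "path_space I E =
     restrict_space (PiM I (\<lambda>_. borel)) {\<omega>. continuous_on I \<omega> \<and> \<omega> ` I \<subseteq> E}"

definition path_shift :: "real \<Rightarrow> (real \<Rightarrow> 'a) \<Rightarrow> real \<Rightarrow> 'a" where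
  "path_shift s \<omega> = (\<lambda>t\<in>{0..}. \<omega> (s + t))"

definition hitting_time :: "'a \<Rightarrow> (real \<Rightarrow> 'a) \<Rightarrow> ennreal" where
  "hitting_time y \<omega> = Inf {ennreal t | t. 0 \<le> t \<and> \<omega> t = y}"

definition law_upto :: "real \<Rightarrow> (real \<Rightarrow> 'a::topological_space) measure \<Rightarrow> (real \<Rightarrow> 'a) measure" where
  "law_upto t M = distr M (path_space {0..t} UNIV) (\<lambda>\<omega>. restrict \<omega> {0..t})"

section \<open>Continuous strong Markov processes\<close>

text \<open>
  Filtrations are indexed by \<open>ennreal\<close> (that is, \<open>[0,\<infinity>]\<close>), so that the library's notion of stopping time
  admits the value \<open>\<infinity>\<close>.
\<close>
definition coord_filtration :: "'a::topological_space set \<Rightarrow> ennreal \<Rightarrow> (real \<Rightarrow> 'a) measure" where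
  "coord_filtration E t = sigma (space (path_space {0..} E))
     {(\<lambda>\<omega>. \<omega> s) -` B \<inter> space (path_space {0..} E) | s B. 0 \<le> s \<and> ennreal s \<le> t \<and> B \<in> sets borel}"

text \<open>Inserting \<open>\<infinity>\<close> only matters at \<open>t = \<infinity>\<close>, where the intersection would otherwise be empty.\<close>
definition right_filtration :: "'a::topological_space set \<Rightarrow> ennreal \<Rightarrow> (real \<Rightarrow> 'a) measure" where
  "right_filtration E t = sigma (space (path_space {0..} E))
     (\<Inter>u\<in>insert \<infinity> {t<..}. sets (coord_filtration E u))"

lemma space_coord_filtration: "space (coord_filtration E t) = space (path_space {0..} E)"
  unfolding coord_filtration_def by (rule space_measure_of) auto

lemma coord_filtration_closed:
  "(\<Inter>u\<in>insert \<infinity> {t<..}. sets (coord_filtration E u)) \<subseteq> Pow (space (path_space {0..} E))"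
  using sets.space_closed[of "coord_filtration E \<infinity>"] by (auto simp: space_coord_filtration)

lemma sets_right_filtration:
  "sets (right_filtration E t) = (\<Inter>u\<in>insert \<infinity> {t<..}. sets (coord_filtration E u))"
  unfolding right_filtration_def
proof (rule sigma_algebra.sets_measure_of_eq)
  show "sigma_algebra (space (path_space {0..} E))
      (\<Inter>u\<in>insert \<infinity> {t<..}. sets (coord_filtration E u))"
    unfolding sigma_algebra_iff2
  proof (intro conjI allI impI ballI coord_filtration_closed)
    fix A assume A: "A \<in> (\<Inter>u\<in>insert \<infinity> {t<..}. sets (coord_filtration E u))"
    show "space (path_space {0..} E) - A \<in> (\<Inter>u\<in>insert \<infinity> {t<..}. sets (coord_filtration E u))"
    proof
      fix u assume "u \<in> insert \<infinity> {t<..}"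
      with A have "A \<in> sets (coord_filtration E u)" by blast
      then show "space (path_space {0..} E) - A \<in> sets (coord_filtration E u)"
        using sets.compl_sets by (metis space_coord_filtration)
    qed
  next
    fix A :: "nat \<Rightarrow> _"
    assume A: "range A \<subseteq> (\<Inter>u\<in>insert \<infinity> {t<..}. sets (coord_filtration E u))"
    show "(\<Union>i. A i) \<in> (\<Inter>u\<in>insert \<infinity> {t<..}. sets (coord_filtration E u))"
    proof
      fix u assume "u \<in> insert \<infinity> {t<..}"
      with A have "range A \<subseteq> sets (coord_filtration E u)" by blast
      then show "(\<Union>i. A i) \<in> sets (coord_filtration E u)" by (rule sets.countable_UN)
    qed
  qed simp
qed

lemma filtration_right_filtration: "filtration (space (path_space {0..} E)) (right_filtration E)"
proof
  show "space (right_filtration E i) = space (path_space {0..} E)" for i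
    unfolding right_filtration_def
    by (rule space_measure_of) (rule coord_filtration_closed)
  show "sets (right_filtration E i) \<subseteq> sets (right_filtration E j)" if "i \<le> j" for i j
    unfolding sets_right_filtration using that by force
qed

text \<open>
  A family \<open>P x\<close>, \<open>x \<in> E\<close>, of laws of a conservative process with continuous paths in \<open>E\<close>, strong Markov
  at all stopping times of the right-continuous filtration.
\<close>
definition strong_markov_family ::
    "'a::topological_space set \<Rightarrow> ('a \<Rightarrow> (real \<Rightarrow> 'a) measure) \<Rightarrow> bool" where
  "strong_markov_family E P \<longleftrightarrow>
     P \<in> restrict_space borel E \<rightarrow>\<^sub>M prob_algebra (path_space {0..} E) \<and>
     (\<forall>x\<in>E. AE \<omega> in P x. \<omega> 0 = x) \<and>
     (\<forall>x\<in>E. \<forall>T. stopping_time (right_filtration E) T \<longrightarrow>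
       (\<forall>A\<in>sets (filtration.pre_sigma (space (path_space {0..} E)) (right_filtration E) T).
        \<forall>B\<in>sets (path_space {0..} E).
          emeasure (P x) {\<omega>\<in>A. T \<omega> < \<infinity> \<and> path_shift (enn2real (T \<omega>)) \<omega> \<in> B} =
          (\<integral>\<^sup>+\<omega>\<in>{\<omega>\<in>A. T \<omega> < \<infinity>}. emeasure (P (\<omega> (enn2real (T \<omega>)))) B \<partial>P x)))"

section \<open>Brownian motion\<close>

text \<open>\<open>W\<close> is the law of standard Brownian motion in a Euclidean space, started at \<open>x\<close>.\<close>
definition brownian_motion :: "'a::euclidean_space \<Rightarrow> (real \<Rightarrow> 'a) measure \<Rightarrow> bool" where
  "brownian_motion x W \<longleftrightarrow>
     W \<in> space (prob_algebra (path_space {0..} UNIV)) \<and>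
     (AE \<omega> in W. \<omega> 0 = x) \<and>
     (\<forall>s t. 0 \<le> s \<and> s < t \<longrightarrow>
        distributed W lborel (\<lambda>\<omega>. \<omega> t - \<omega> s)
          (\<lambda>v. ennreal ((2 * pi * (t - s)) powr (- real DIM('a) / 2) *
                         exp (- (norm v)\<^sup>2 / (2 * (t - s)))))) \<and>
     (\<forall>n (\<tau> :: nat \<Rightarrow> real). 0 \<le> \<tau> 0 \<and> mono \<tau> \<longrightarrow>
        prob_space.indep_vars W (\<lambda>_. borel) (\<lambda>i \<omega>. \<omega> (\<tau> (Suc i)) - \<omega> (\<tau> i)) {..<n})"

section \<open>The Macdonald function and the diffusion BES(0, beta down)\<close>

text \<open>The classical integral formula for \<open>K\<^sub>\<nu>(x)\<close>, for \<open>x > 0\<close>.\<close>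
definition macdonald :: "real \<Rightarrow> real \<Rightarrow> real" where
  "macdonald \<nu> x = (LBINT t:{0..}. exp (- x * cosh t) * cosh (\<nu> * t))"

definition bes_drift :: "real \<Rightarrow> real \<Rightarrow> real" where
  "bes_drift \<beta> x = 1 / (2 * x) -
     sqrt (2 * \<beta>) * (macdonald 1 (sqrt (2 * \<beta>) * x) / macdonald 0 (sqrt (2 * \<beta>) * x))"

definition bes_scale :: "real \<Rightarrow> real \<Rightarrow> real" where
  "bes_scale \<beta> x = (LBINT y:{0<..<x}. 1 / (y * (macdonald 0 (sqrt (2 * \<beta>) * y))\<^sup>2))"

definition bes_speed :: "real \<Rightarrow> real measure" where
  "bes_speed \<beta> = density lborel
     (\<lambda>x. ennreal (2 * x * (macdonald 0 (sqrt (2 * \<beta>) * x))\<^sup>2) * indicator {0<..} x)"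

text \<open>
  \<open>X\<close> has generator \<open>\<onehalf> f'' + b f'\<close> in the open half-line, tested on \<open>C\<^sup>2\<close> functions with compact support
  in \<open>(0,\<infinity>)\<close>.
\<close>
definition interior_generator :: "(real \<Rightarrow> real) \<Rightarrow> (real \<Rightarrow> (real \<Rightarrow> real) measure) \<Rightarrow> bool" where
  "interior_generator b X \<longleftrightarrow>
     (\<forall>f f' f'' l r x. 0 < l \<and> (\<forall>y. y \<notin> {l..r} \<longrightarrow> f y = 0) \<and>
        (\<forall>y. (f has_real_derivative f' y) (at y)) \<and>
        (\<forall>y. (f' has_real_derivative f'' y) (at y)) \<and> continuous_on UNIV f'' \<and> 0 < x \<longrightarrow>
        ((\<lambda>t. ((\<integral>\<omega>. f (\<omega> t) \<partial>X x) - f x) / t) \<longlongrightarrow> f'' x / 2 + b x * f' x) (at_right 0))"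

text \<open>
  Scale function and speed measure of a diffusion on \<open>[0,\<infinity>)\<close>, normalised so that the generator is
  \<open>d/dm d/ds\<close>: exit probabilities and mean exit times of intervals. The mean exit time from \<open>[0,b)\<close> involves
  the Green function with the derivative with respect to \<open>s\<close> vanishing at \<open>0\<close>. Hence this equation says that
  \<open>0\<close> is reflecting; a possible atom \<open>m {0}\<close> would contribute, and the reflection is instantaneous iff there
  is none.
\<close>
definition has_scale_function :: "(real \<Rightarrow> real) \<Rightarrow> (real \<Rightarrow> (real \<Rightarrow> real) measure) \<Rightarrow> bool" where
  "has_scale_function s X \<longleftrightarrow>
     (\<forall>a x b. 0 \<le> a \<and> a < x \<and> x < b \<longrightarrow>
        measure (X x) {\<omega>\<in>space (X x). hitting_time b \<omega> < hitting_time a \<omega>} = (s x - s a) / (s b - s a))"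

definition has_speed_measure ::
    "(real \<Rightarrow> real) \<Rightarrow> real measure \<Rightarrow> (real \<Rightarrow> (real \<Rightarrow> real) measure) \<Rightarrow> bool" where
  "has_speed_measure s m X \<longleftrightarrow>
     (\<forall>a x b. 0 \<le> a \<and> a < x \<and> x < b \<longrightarrow>
        (\<integral>\<^sup>+\<omega>. min (hitting_time a \<omega>) (hitting_time b \<omega>) \<partial>X x) =
        (\<integral>\<^sup>+y\<in>{a<..<b}. ennreal ((s (min x y) - s a) * (s b - s (max x y)) / (s b - s a)) \<partial>m)) \<and>
     (\<forall>x b. 0 \<le> x \<and> x < b \<longrightarrow>
        (\<integral>\<^sup>+\<omega>. hitting_time b \<omega> \<partial>X x) = (\<integral>\<^sup>+y\<in>{0..<b}. ennreal (s b - s (max x y)) \<partial>m))"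

text \<open>\<open>X x\<close> is the law of the diffusion started at \<open>x \<in> [0,\<infinity>)\<close>.\<close>
definition bes_down :: "real \<Rightarrow> (real \<Rightarrow> (real \<Rightarrow> real) measure) \<Rightarrow> bool" where
  "bes_down \<beta> X \<longleftrightarrow>
     strong_markov_family {0..} X \<and>
     interior_generator (bes_drift \<beta>) X \<and>
     has_scale_function (bes_scale \<beta>) X \<and>
     has_speed_measure (bes_scale \<beta>) (bes_speed \<beta>) X"

section \<open>The planar process\<close>

definition radial :: "(real \<Rightarrow> complex) \<Rightarrow> real \<Rightarrow> real" where
  "radial \<omega> = (\<lambda>t\<in>{0..}. cmod (\<omega> t))"

definition circular :: "(real \<Rightarrow> real) \<Rightarrow> real \<Rightarrow> real" where
  "circular \<gamma> = (\<lambda>t\<in>{0..}. \<gamma> t rmod (2 * pi))"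

definition clock :: "(real \<Rightarrow> complex) \<Rightarrow> real \<Rightarrow> real" where
  "clock \<omega> t = (LBINT s:{0..t}. 1 / (cmod (\<omega> s))\<^sup>2)"

text \<open>
  A process with law \<open>M\<close> started at \<open>z \<noteq> 0\<close> is, until it hits \<open>0\<close>, its modulus times \<open>exp\<close> of \<open>\<i>\<close> times an
  independent circular Brownian motion run with the clock. The process and the Brownian motion \<open>\<gamma>\<close> whose
  reduction mod \<open>2\<pi>\<close> is the circular one are realised jointly by a coupling \<open>Q\<close>; \<open>\<gamma>\<close> is kept unreduced
  there because, unlike \<open>circular \<gamma>\<close>, it has continuous real paths.
\<close>
definition skew_product :: "complex \<Rightarrow> (real \<Rightarrow> complex) measure \<Rightarrow> bool" where
  "skew_product z M \<longleftrightarrow>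
     (\<exists>Q \<in> space (prob_algebra (path_space {0..} UNIV \<Otimes>\<^sub>M path_space {0..} (UNIV :: real set))).
        distr Q (path_space {0..} UNIV) fst = M \<and>
        brownian_motion (Arg z) (distr Q (path_space {0..} UNIV) snd) \<and>
        prob_space.indep_var Q
          (path_space {0..} {0..}) (\<lambda>(\<omega>, \<gamma>). radial \<omega>)
          (PiM {0..} (\<lambda>_. borel)) (\<lambda>(\<omega>, \<gamma>). circular \<gamma>) \<and>
        (AE (\<omega>, \<gamma>) in Q. \<forall>t\<ge>0. ennreal t < hitting_time 0 \<omega> \<longrightarrow>
           \<omega> t = complex_of_real (cmod (\<omega> t)) *
                  exp (\<i> * complex_of_real (circular \<gamma> (clock \<omega> t)))))"

text \<open>\<open>P z\<close> is the law of \<open>(Z\<^sub>t)\<close> started at \<open>z\<close>.\<close>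
definition planar_bes_down :: "real \<Rightarrow> (complex \<Rightarrow> (real \<Rightarrow> complex) measure) \<Rightarrow> bool" where
  "planar_bes_down \<beta> P \<longleftrightarrow>
     strong_markov_family UNIV P \<and>
     (\<exists>X. bes_down \<beta> X \<and> (\<forall>z. distr (P z) (path_space {0..} {0..}) radial = X (cmod z))) \<and>
     (\<forall>z. z \<noteq> 0 \<longrightarrow> skew_product z (P z))"

section \<open>Lebesgue decomposition\<close>

definition mutually_singular :: "'a measure \<Rightarrow> 'a measure \<Rightarrow> bool" where
  "mutually_singular M N \<longleftrightarrow> sets M = sets N \<and>
     (\<exists>A\<in>sets M. emeasure M A = 0 \<and> emeasure N (space N - A) = 0)"

definition lebesgue_decomposition ::
    "'a measure \<Rightarrow> 'a measure \<Rightarrow> 'a measure \<Rightarrow> 'a measure \<Rightarrow> bool" where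
  "lebesgue_decomposition N M Na Ns \<longleftrightarrow>
     sets M = sets N \<and> sets Na = sets N \<and> sets Ns = sets N \<and>
     (\<forall>A\<in>sets N. emeasure N A = emeasure Na A + emeasure Ns A) \<and>
     absolutely_continuous M Na \<and> mutually_singular Ns M"

text \<open>For sigma-finite \<open>M\<close> and \<open>N\<close> the decomposition exists and is unique.\<close>
definition has_nonzero_singular_part :: "'a measure \<Rightarrow> 'a measure \<Rightarrow> bool" where
  "has_nonzero_singular_part N M \<longleftrightarrow>
     (\<exists>Na Ns. lebesgue_decomposition N M Na Ns \<and> emeasure Ns (space Ns) \<noteq> 0)"

end

theory Submission
  imports Defs "HOL-Real_Asymp.Real_Asymp"
begin

text \<open>
  The two laws are distinguished by the event that the path visits the origin at a positive time.

  Planar Brownian motion a.s. does not: compare, after the first time it comes within \<open>\<epsilon>\<close> of the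
  origin, the time it then spends within \<open>2 \<epsilon>\<close> (at least of order \<open>\<epsilon>\<^sup>2 ln (1 / \<epsilon>)\<close>) with the
  unconditional expectation of this time (of order \<open>\<epsilon>\<^sup>2\<close>).

  For the modulus under \<open>P\<close>, the bounds \<open>K\<^sub>0(y) \<le> C / sqrt y\<close> and \<open>K\<^sub>0(y) \<ge> c ln (1 / y)\<close> show that the
  scale function is finite at the origin, increasing and unbounded, and that the speed density is
  bounded. Thus the origin is hit a.s., and, going down along points that are equidistant in scale,
  it is hit before any given time with positive probability. Started at the origin, the
  diffusion first moves to some \<open>b > 0\<close> in a short time.
\<close>

section \<open>Lebesgue decomposition and path events\<close>

text \<open>Being at the origin is a property of the modulus, so the probability of the event under
  \<open>P z0\<close> is a probability for \<open>X\<close> alone. Only positive times count,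
  because \<open>z0\<close> may be 0. Two obstacles shape the argument.
  \<open>brownian_motion\<close> gives Gaussian increments, independent along deterministic times;
  so the first approach to the origin is the first index of a finite grid. The resulting bound does
  not depend on the grid, so the grid is refined with \<epsilon> fixed, and only afterwards does
  \<epsilon> tend to 0. The logarithm is the integral of 1/r over
  \<open>\<epsilon>\<^sup>2 \<le> r \<le> 1\<close>, where 1/r is the decay in time of the planar
  Gaussian density. For the diffusion, scale and speed give exit probabilities and mean exit times.
  One interval from the starting point down to 0 may have a mean exit time above the prescribed
  time. With n steps, each costs about (scale increment) * (distance), and the scale increment is of
  order 1/n while the distances have a bounded sum; the total is of order 1/n. The strong Markov
  property multiplies the probabilities of the steps; the product may be tiny, but a nonzero
  singular part needs only positivity.\<close>

text \<open>The decomposition itself must be exhibited. \<open>B\<close> is an \<open>M\<close>-null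
  set of largest \<open>N\<close>-mass, a countable union along a maximising sequence.
  \<open>N\<close> on \<open>B\<close> is singular; \<open>N\<close> off \<open>B\<close> is
  absolutely continuous, since an \<open>M\<close>-null set with \<open>N\<close>-mass outside
  \<open>B\<close> could be added to \<open>B\<close>.\<close>

lemma has_nonzero_singular_partI:
  assumes N: "finite_measure N" and sets: "sets N = sets M"
    and E: "E \<in> sets M" "emeasure M E = 0" "emeasure N E \<noteq> 0"
  shows "has_nonzero_singular_part N M"
proof -
  interpret N: finite_measure N by fact
  define Z where "Z = {A \<in> sets M. emeasure M A = 0}"
  define c where "c = (SUP A\<in>Z. emeasure N A)"
  have "Z \<noteq> {}" using E by (auto simp: Z_def)
  then obtain f where f: "range f \<subseteq> emeasure N ` Z" "c = (SUP n::nat. f n)"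
    unfolding c_def using ennreal_SUP_countable_SUP[of Z "emeasure N"] by auto
  then have "\<forall>n. \<exists>A. A \<in> Z \<and> f n = emeasure N A" by blast
  then obtain A where A: "\<And>n. A n \<in> Z" "\<And>n. f n = emeasure N (A n)" by metis
  define B where "B = (\<Union>n. A n)"
  have Am: "A n \<in> sets M" for n using A by (auto simp: Z_def)
  have Bm: "B \<in> sets M" "B \<in> sets N" using Am sets by (auto simp: B_def)
  have B0: "emeasure M B = 0"
    unfolding B_def using A(1) Am by (intro emeasure_UN_eq_0) (auto simp: Z_def)
  have ub: "emeasure N C \<le> c" if "C \<in> Z" for C
    unfolding c_def using that by (rule SUP_upper)
  have "c \<le> emeasure N B"
    unfolding f(2) using Bm by (intro SUP_least) (auto simp: A(2) B_def intro!: emeasure_mono)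
  then have cB: "emeasure N B = c" using ub[of B] Bm B0 by (intro antisym) (auto simp: Z_def)
  \<comment> \<open>Finiteness of \<open>c\<close> permits its cancellation when maximality is used
    below.\<close>
  have cfin: "c \<noteq> \<infinity>" using cB N.emeasure_finite[of B] by simp
  define Ns where "Ns = density N (indicator B)"
  define Na where "Na = density N (indicator (space N - B))"
  have eNs: "emeasure Ns C = emeasure N (B \<inter> C)" if "C \<in> sets N" for C
    using that Bm(2) by (simp add: Ns_def emeasure_restricted)
  have eNa: "emeasure Na C = emeasure N (C - B)" if "C \<in> sets N" for C
  proof -
    have "(space N - B) \<inter> C = C - B" using sets.sets_into_space[OF that] by auto
    then show ?thesis
      using that Bm(2) by (simp add: Na_def emeasure_restricted)
  qed
  have sp: "space N = space M" using sets by (rule sets_eq_imp_space_eq)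
  have "lebesgue_decomposition N M Na Ns"
    unfolding lebesgue_decomposition_def
  proof (intro conjI ballI)
    show "sets M = sets N" "sets Na = sets N" "sets Ns = sets N"
      using sets by (auto simp: Na_def Ns_def)
    show "emeasure N C = emeasure Na C + emeasure Ns C" if C: "C \<in> sets N" for C
    proof -
      have "emeasure N ((C - B) \<union> (B \<inter> C)) = emeasure N (C - B) + emeasure N (B \<inter> C)"
        using C Bm by (intro plus_emeasure[symmetric]) auto
      also have "(C - B) \<union> (B \<inter> C) = C" by auto
      finally show ?thesis using eNs eNa C by simp
    qed
    show "absolutely_continuous M Na"
      unfolding absolutely_continuous_def
    proof
      fix C assume "C \<in> null_sets M"
      then have C: "C \<in> sets M" "C \<in> sets N" "emeasure M C = 0" using sets by auto
      have "emeasure M (B \<union> C) = 0"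
        using emeasure_subadditive[of B M C] Bm C B0 by simp
      then have "emeasure N (B \<union> C) \<le> c" using Bm C by (intro ub) (auto simp: Z_def)
      moreover have "emeasure N (B \<union> (C - B)) = emeasure N B + emeasure N (C - B)"
        using C Bm by (intro plus_emeasure[symmetric]) auto
      ultimately have "c + emeasure N (C - B) \<le> c + 0" using cB by simp
      then have "emeasure N (C - B) = 0"
        using cfin by (simp add: ennreal_add_left_cancel_le)
      then show "C \<in> null_sets Na" using eNa C sets by (auto simp: null_sets_def Na_def)
    qed
    have sNs: "space Ns = space N" by (simp add: Ns_def)
    show "mutually_singular Ns M"
      unfolding mutually_singular_def
    proof (intro conjI bexI[of _ "space N - B"])
      show "sets Ns = sets M" using sets by (simp add: Ns_def)
      show "space N - B \<in> sets Ns" using Bm by (simp add: Ns_def)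
      have "B \<inter> (space N - B) = {}" by auto
      then show "emeasure Ns (space N - B) = 0" using eNs[of "space N - B"] Bm by auto
      have "space M - (space N - B) = B" using sets.sets_into_space[OF Bm(1)] sp by auto
      then show "emeasure M (space M - (space N - B)) = 0" using B0 by simp
    qed
  qed
  moreover have "emeasure Ns (space Ns) \<noteq> 0"
  proof -
    have "emeasure Ns (space Ns) = c"
      using eNs[of "space N"] cB sets.sets_into_space[OF Bm(2)] by (simp add: Ns_def Int_absorb2)
    moreover have "emeasure N E \<le> c" using E by (intro ub) (auto simp: Z_def)
    ultimately show ?thesis using E by auto
  qed
  ultimately show ?thesis unfolding has_nonzero_singular_part_def by blast
qed

section \<open>Path spaces and the measurability of visits to a point\<close>

lemma space_path_space:
  "space (path_space I E) = {\<omega> \<in> extensional I. continuous_on I \<omega> \<and> \<omega> ` I \<subseteq> E}"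
  by (auto simp: path_space_def space_restrict_space space_PiM PiE_def)

lemma measurable_path_space_component:
  assumes "t \<in> I"
  shows "(\<lambda>\<omega>. \<omega> t) \<in> path_space I E \<rightarrow>\<^sub>M borel"
  unfolding path_space_def using assms
  by (intro measurable_restrict_space1 measurable_component_singleton)

lemma measurable_path_spaceI:
  assumes "\<And>x. x \<in> space M \<Longrightarrow> f x \<in> space (path_space I E)"
    and "\<And>t. t \<in> I \<Longrightarrow> (\<lambda>x. f x t) \<in> M \<rightarrow>\<^sub>M borel"
  shows "f \<in> M \<rightarrow>\<^sub>M path_space I E"
  unfolding path_space_def
proof (rule measurable_restrict_space2)
  show "f \<in> space M \<rightarrow> {\<omega>. continuous_on I \<omega> \<and> \<omega> ` I \<subseteq> E}"
    using assms(1) by (auto simp: space_path_space)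
  show "f \<in> M \<rightarrow>\<^sub>M Pi\<^sub>M I (\<lambda>_. borel)"
    using assms by (intro measurable_PiM_single') (auto simp: space_path_space PiE_def)
qed

lemma measurable_radial [measurable]:
  "radial \<in> path_space {0..} UNIV \<rightarrow>\<^sub>M path_space {0..} {0..}"
proof (rule measurable_path_spaceI)
  show "radial \<omega> \<in> space (path_space {0..} {0..})" if "\<omega> \<in> space (path_space {0..} UNIV)" for \<omega>
  proof -
    have "continuous_on {0..} (\<lambda>t. cmod (\<omega> t))"
      using that by (intro continuous_on_norm) (auto simp: space_path_space)
    then have "continuous_on {0..} (radial \<omega>)"
      by (rule continuous_on_eq) (auto simp: radial_def)
    then show ?thesis by (auto simp: space_path_space radial_def)
  qed
  show "(\<lambda>\<omega>. radial \<omega> t) \<in> borel_measurable (path_space {0..} UNIV)" if "t \<in> {0..}" for t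
    using that measurable_compose[OF measurable_path_space_component[of t "{0..}" UNIV] borel_measurable_norm]
    by (simp add: radial_def)
qed

lemma measurable_restrict_path [measurable]:
  "J \<subseteq> I \<Longrightarrow> (\<lambda>\<omega>. restrict \<omega> J) \<in> path_space I E \<rightarrow>\<^sub>M path_space J E"
  by (rule measurable_path_spaceI)
     (auto simp: space_path_space subset_eq intro: continuous_on_subset measurable_path_space_component)

text \<open>Along a countable dense set of times, a path comes arbitrarily close to \<open>y\<close>
  iff it attains \<open>y\<close>: one direction is continuity, the other is that the distance to
  \<open>y\<close> attains its minimum on the compact interval. \<open>M\<close> is arbitrary
  because the lemma serves path spaces, Brownian laws and the coordinate filtration.\<close>

lemma sets_hits_interval:
  fixes y :: "'a::metric_space"
  assumes cont: "\<And>\<omega>. \<omega> \<in> space M \<Longrightarrow> continuous_on {a..b} \<omega>"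
    and meas: "\<And>q. q \<in> {a..b} \<Longrightarrow> (\<lambda>\<omega>. \<omega> q) \<in> M \<rightarrow>\<^sub>M borel"
  shows "{\<omega> \<in> space M. \<exists>s\<in>{a..b::real}. \<omega> s = y} \<in> sets M"
proof -
  obtain T where T: "countable T" "T \<subseteq> {a..b}" "{a..b} \<subseteq> closure T"
    using separable[of "{a..b}"] by auto
  have iff: "(\<exists>s\<in>{a..b}. \<omega> s = y) \<longleftrightarrow> (\<forall>k. \<exists>q\<in>T. \<omega> q \<in> ball y (1 / real (Suc k)))"
    if \<omega>: "\<omega> \<in> space M" for \<omega>
  proof
    assume "\<exists>s\<in>{a..b}. \<omega> s = y"
    then obtain s where s: "s \<in> {a..b}" "\<omega> s = y" by blast
    show "\<forall>k. \<exists>q\<in>T. \<omega> q \<in> ball y (1 / real (Suc k))"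
    proof
      fix k
      obtain d where d: "d > 0" "\<And>x. x \<in> {a..b} \<Longrightarrow> dist x s < d \<Longrightarrow> dist (\<omega> x) (\<omega> s) < 1 / real (Suc k)"
        using cont[OF \<omega>] s(1) unfolding continuous_on_iff
        by (metis divide_pos_pos of_nat_0_less_iff zero_less_Suc zero_less_one)
      have "s \<in> closure T" using T s by blast
      then obtain q where "q \<in> T" "dist q s < d" using d(1) closure_approachable by blast
      then show "\<exists>q\<in>T. \<omega> q \<in> ball y (1 / real (Suc k))"
        using d(2)[of q] T s by (intro bexI[of _ q]) (auto simp: dist_commute)
    qed
  next
    assume R: "\<forall>k. \<exists>q\<in>T. \<omega> q \<in> ball y (1 / real (Suc k))"
    then have "{a..b} \<noteq> {}" using T(2) by blast
    moreover have "continuous_on {a..b} (\<lambda>s. dist (\<omega> s) y)"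
      using cont[OF \<omega>] by (intro continuous_intros)
    ultimately obtain s where s: "s \<in> {a..b}" "\<And>x. x \<in> {a..b} \<Longrightarrow> dist (\<omega> s) y \<le> dist (\<omega> x) y"
      using continuous_attains_inf[of "{a..b}" "\<lambda>s. dist (\<omega> s) y"] by auto
    have "dist (\<omega> s) y < 1 / real (Suc k)" for k
    proof -
      obtain q where "q \<in> T" "\<omega> q \<in> ball y (1 / real (Suc k))" using R by blast
      then show ?thesis using s(2)[of q] T(2) by (auto simp: dist_commute)
    qed
    then have "\<not> dist (\<omega> s) y > 0" by (metis nat_approx_posE not_less_iff_gr_or_eq)
    then show "\<exists>s\<in>{a..b}. \<omega> s = y" using s(1) by auto
  qed
  have "{\<omega> \<in> space M. \<exists>s\<in>{a..b}. \<omega> s = y} =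
      {\<omega> \<in> space M. \<forall>k. \<exists>q\<in>T. \<omega> q \<in> ball y (1 / real (Suc k))}"
    using iff by auto
  also have "\<dots> \<in> sets M"
    using T meas by (intro sets.sets_Collect_countable_All sets.sets_Collect_countable_Ex'
        measurable_sets_Collect[OF meas, of _ "\<lambda>x. x \<in> ball y _"])
      (auto simp del: mem_ball)
  finally show ?thesis .
qed

lemma sets_hits_path_space:
  fixes y :: "'a::metric_space"
  assumes "{a..b} \<subseteq> I"
  shows "{\<omega> \<in> space (path_space I E). \<exists>s\<in>{a..b::real}. \<omega> s = y} \<in> sets (path_space I E)"
  using assms by (intro sets_hits_interval)
    (auto simp: space_path_space subset_eq intro: continuous_on_subset measurable_path_space_component)

text \<open>\<open>s > 0\<close> excludes the visit at time 0 when the path starts at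
  \<open>y\<close>. An extended horizon lets one event serve both \<open>[0, t]\<close> and
  \<open>[0, \<infinity>)\<close>, and the parameter \<open>\<Omega>\<close> lets it serve planar,
  radial and restricted paths.\<close>

definition hits_within :: "ereal \<Rightarrow> (real \<Rightarrow> 'a) set \<Rightarrow> 'a \<Rightarrow> (real \<Rightarrow> 'a) set" where
  "hits_within t \<Omega> y = {\<omega> \<in> \<Omega>. \<exists>s>0. ereal s \<le> t \<and> \<omega> s = y}"

text \<open>The positive times up to \<open>t\<close> are exhausted by compact intervals. The
  minimum with \<open>n\<close> is taken before \<open>real_of_ereal\<close>, which sends
  \<infinity> to 0; for \<open>t = -\<infinity>\<close> that default makes the interval empty, as it
  should be.\<close>

lemma sets_hits_within:
  fixes y :: "'a::metric_space"
  assumes "\<And>s. 0 < s \<Longrightarrow> ereal s \<le> t \<Longrightarrow> s \<in> I"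
  shows "hits_within t (space (path_space I E)) y \<in> sets (path_space I E)"
proof -
  have "hits_within t (space (path_space I E)) y =
      (\<Union>n::nat. {\<omega> \<in> space (path_space I E). \<exists>s\<in>{1 / real (Suc n)..real_of_ereal (min t (ereal (real n)))}. \<omega> s = y})"
  proof (intro set_eqI iffI)
    fix \<omega> assume "\<omega> \<in> hits_within t (space (path_space I E)) y"
    then obtain s where s: "\<omega> \<in> space (path_space I E)" "s > 0" "ereal s \<le> t" "\<omega> s = y"
      by (auto simp: hits_within_def)
    obtain n1 where n1: "1 / real (Suc n1) < s" using s(2) by (rule nat_approx_posE)
    obtain n2 where n2: "s < real n2" using reals_Archimedean2 by blast
    define n where "n = max n1 n2"
    have "1 / real (Suc n) \<le> 1 / real (Suc n1)" by (auto simp: n_def frac_le)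
    moreover have "s \<le> real n" using n2 by (auto simp: n_def)
    moreover have "s \<le> real_of_ereal (min t (ereal (real n)))"
      using s(3) \<open>s \<le> real n\<close> by (cases t) (auto simp: min_def)
    ultimately show "\<omega> \<in> (\<Union>n::nat. {\<omega> \<in> space (path_space I E). \<exists>s\<in>{1 / real (Suc n)..real_of_ereal (min t (ereal (real n)))}. \<omega> s = y})"
      using s n1 by (intro UN_I[of n]) auto
  next
    fix \<omega> assume "\<omega> \<in> (\<Union>n::nat. {\<omega> \<in> space (path_space I E). \<exists>s\<in>{1 / real (Suc n)..real_of_ereal (min t (ereal (real n)))}. \<omega> s = y})"
    then obtain n s where s: "\<omega> \<in> space (path_space I E)" "1 / real (Suc n) \<le> s"
      "s \<le> real_of_ereal (min t (ereal (real n)))" "\<omega> s = y" by auto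
    have pos: "s > 0" using s(2) by (metis divide_pos_pos less_le_trans of_nat_0_less_iff zero_less_Suc zero_less_one)
    have "ereal s \<le> t" using s(3) pos by (cases t) (auto simp: min_def split: if_splits)
    with s pos show "\<omega> \<in> hits_within t (space (path_space I E)) y" by (auto simp: hits_within_def)
  qed
  also have "\<dots> \<in> sets (path_space I E)"
  proof (intro sets.countable_UN subsetI)
    fix A assume "A \<in> range (\<lambda>n::nat. {\<omega> \<in> space (path_space I E).
      \<exists>s\<in>{1 / real (Suc n)..real_of_ereal (min t (ereal (real n)))}. \<omega> s = y})"
    then obtain n where A: "A = {\<omega> \<in> space (path_space I E).
      \<exists>s\<in>{1 / real (Suc n)..real_of_ereal (min t (ereal (real n)))}. \<omega> s = y}" by blast
    show "A \<in> sets (path_space I E)"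
      unfolding A
    proof (rule sets_hits_path_space, rule subsetI)
      fix s assume s: "s \<in> {1 / real (Suc n)..real_of_ereal (min t (ereal (real n)))}"
      then have pos: "s > 0" by (metis atLeastAtMost_iff divide_pos_pos less_le_trans of_nat_0_less_iff zero_less_Suc zero_less_one)
      have "ereal s \<le> t" using s pos by (cases t) (auto simp: min_def split: if_splits)
      then show "s \<in> I" using assms pos by blast
    qed
  qed
  finally show ?thesis .
qed

section \<open>Planar Brownian motion avoids the origin\<close>

lemma brownian_motion_prob_space: "brownian_motion x W \<Longrightarrow> prob_space W"
  by (simp add: brownian_motion_def space_prob_algebra)

lemma sets_brownian_motion: "brownian_motion x W \<Longrightarrow> sets W = sets (path_space {0..} UNIV)"
  by (simp add: brownian_motion_def space_prob_algebra)

lemma measurable_brownian_motion: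
  "brownian_motion x W \<Longrightarrow> 0 \<le> t \<Longrightarrow> (\<lambda>\<omega>. \<omega> t) \<in> W \<rightarrow>\<^sub>M borel"
  using measurable_path_space_component[of t "{0..}" UNIV] sets_brownian_motion
  by (metis atLeast_iff measurable_cong_sets)

section \<open>Gaussian bounds for planar increments\<close>

lemma emeasure_planar_increment:
  fixes z :: complex
  assumes "brownian_motion z W" "0 \<le> s" "s < t" "A \<in> sets borel"
  shows "emeasure W {\<omega> \<in> space W. \<omega> t - \<omega> s \<in> A} =
    (\<integral>\<^sup>+v. ennreal (exp (- (norm v)\<^sup>2 / (2 * (t - s))) / (2 * pi * (t - s))) * indicator A v \<partial>lborel)"
proof -
  have d: "distributed W lborel (\<lambda>\<omega>. \<omega> t - \<omega> s)
      (\<lambda>v. ennreal ((2 * pi * (t - s)) powr (- real DIM(complex) / 2) *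
                         exp (- (norm v)\<^sup>2 / (2 * (t - s)))))"
    using assms unfolding brownian_motion_def by blast
  have p: "(2 * pi * (t - s)) powr (- real DIM(complex) / 2) = 1 / (2 * pi * (t - s))"
    using assms(3) by (simp add: powr_minus_divide)
  have "(\<lambda>\<omega>. \<omega> t - \<omega> s) -` A \<inter> space W = {\<omega> \<in> space W. \<omega> t - \<omega> s \<in> A}" by auto
  with distributed_emeasure[OF d, of A] assms(4) show ?thesis
    unfolding p by (simp add: mult.commute)
qed

lemma emeasure_complex_ball: "0 \<le> r \<Longrightarrow> emeasure lborel (ball (c::complex) r) = ennreal (pi * r\<^sup>2)"
  by (simp add: emeasure_ball unit_ball_vol_2)

lemma planar_increment_ball_le:
  fixes z c :: complex
  assumes "brownian_motion z W" "0 \<le> s" "s < t" "0 \<le> \<epsilon>"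
  shows "measure W {\<omega> \<in> space W. \<omega> t - \<omega> s \<in> ball c \<epsilon>} \<le> \<epsilon>\<^sup>2 / (2 * (t - s))"
proof -
  interpret prob_space W using assms(1) by (rule brownian_motion_prob_space)
  have "emeasure W {\<omega> \<in> space W. \<omega> t - \<omega> s \<in> ball c \<epsilon>} \<le>
     (\<integral>\<^sup>+v. ennreal (1 / (2 * pi * (t - s))) * indicator (ball c \<epsilon>) v \<partial>lborel)"
    unfolding emeasure_planar_increment[OF assms(1-3) borel_open[OF open_ball]]
    using assms by (intro nn_integral_mono mult_right_mono ennreal_leI divide_right_mono) auto
  also have "\<dots> = ennreal (\<epsilon>\<^sup>2 / (2 * (t - s)))"
    using assms by (simp add: nn_integral_cmult_indicator emeasure_complex_ball ennreal_mult[symmetric])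
  finally show ?thesis
    using assms by (simp add: emeasure_eq_measure)
qed

text \<open>The condition \<open>s + \<epsilon>\<^sup>2 \<le> t\<close> keeps the Gaussian exponent
  above -1/2 on the whole disc, which is the origin of \<open>exp (- 1 / 2)\<close>.\<close>

lemma planar_increment_ball_ge:
  fixes z :: complex
  assumes "brownian_motion z W" "0 \<le> s" "0 < \<epsilon>" "s + \<epsilon>\<^sup>2 \<le> t"
  shows "exp (- 1 / 2) * \<epsilon>\<^sup>2 / (2 * (t - s)) \<le> measure W {\<omega> \<in> space W. \<omega> t - \<omega> s \<in> ball 0 \<epsilon>}"
proof -
  interpret prob_space W using assms(1) by (rule brownian_motion_prob_space)
  have "0 < \<epsilon>\<^sup>2" using assms by simp
  then have st: "s < t" using assms by linarith
  have "ennreal (exp (- 1 / 2) * \<epsilon>\<^sup>2 / (2 * (t - s))) =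
      (\<integral>\<^sup>+v. ennreal (exp (- 1 / 2) / (2 * pi * (t - s))) * indicator (ball 0 \<epsilon>) (v::complex) \<partial>lborel)"
    using assms st by (simp add: nn_integral_cmult_indicator emeasure_complex_ball ennreal_mult[symmetric])
  also have "\<dots> \<le> emeasure W {\<omega> \<in> space W. \<omega> t - \<omega> s \<in> ball 0 \<epsilon>}"
    unfolding emeasure_planar_increment[OF assms(1,2) st borel_open[OF open_ball]]
  proof (rule nn_integral_mono)
    fix v :: complex
    have "exp (- 1 / 2) \<le> exp (- (norm v)\<^sup>2 / (2 * (t - s)))" if "v \<in> ball 0 \<epsilon>"
    proof -
      have "(norm v)\<^sup>2 \<le> \<epsilon>\<^sup>2" using that by (intro power_mono) auto
      then have "(norm v)\<^sup>2 \<le> t - s" using assms by linarith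
      then show ?thesis using st by (simp add: field_simps)
    qed
    then show "ennreal (exp (- 1 / 2) / (2 * pi * (t - s))) * indicator (ball 0 \<epsilon>) v
      \<le> ennreal (exp (- (norm v)\<^sup>2 / (2 * (t - s))) / (2 * pi * (t - s))) * indicator (ball 0 \<epsilon>) v"
      using st by (auto simp: indicator_def intro!: ennreal_leI divide_right_mono)
  qed
  finally show ?thesis
    using assms st by (simp add: emeasure_eq_measure)
qed

section \<open>First approach to the origin along a time grid\<close>

text \<open>Index 0 is left out of the competition: it is reserved for the starting time, where the
  path may be at the origin.\<close>

definition grid_first :: "(nat \<Rightarrow> real) \<Rightarrow> real \<Rightarrow> nat \<Rightarrow> (real \<Rightarrow> complex) set" where
  "grid_first \<tau> \<epsilon> j = {\<omega>. norm (\<omega> (\<tau> j)) < \<epsilon> \<and> (\<forall>i\<in>{1..<j}. \<not> norm (\<omega> (\<tau> i)) < \<epsilon>)}"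

lemma sets_grid_first:
  assumes W: "brownian_motion z W" and \<tau>: "\<And>i. 0 \<le> \<tau> i"
  shows "{\<omega> \<in> space W. \<omega> \<in> grid_first \<tau> \<epsilon> j} \<in> sets W"
proof -
  have [measurable]: "(\<lambda>\<omega>. \<omega> (\<tau> i)) \<in> W \<rightarrow>\<^sub>M borel" for i
    using W \<tau> by (rule measurable_brownian_motion)
  show ?thesis unfolding grid_first_def by measurable
qed

text \<open>The starting value is almost surely \<open>z\<close>, so the position at \<open>\<tau> j\<close> is \<open>z\<close> plus increments.\<close>
lemma grid_first_indep:
  fixes z :: complex and \<tau> :: "nat \<Rightarrow> real"
  assumes W: "brownian_motion z W" and \<tau>: "mono \<tau>" "\<tau> 0 = 0" and t: "\<tau> j \<le> t"
    and A: "A \<in> sets borel"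
  shows "measure W {\<omega> \<in> space W. \<omega> \<in> grid_first \<tau> \<epsilon> j \<and> \<omega> t - \<omega> (\<tau> j) \<in> A} =
    measure W {\<omega> \<in> space W. \<omega> \<in> grid_first \<tau> \<epsilon> j} * measure W {\<omega> \<in> space W. \<omega> t - \<omega> (\<tau> j) \<in> A}"
proof -
  interpret prob_space W using W by (rule brownian_motion_prob_space)
  \<comment> \<open>The grid up to index \<open>j\<close>, then constantly \<open>t\<close>. Given
    the starting value, the increments with index below \<open>j\<close> determine
    \<open>grid_first\<close>, and the one with index \<open>j\<close> is
    \<open>\<omega> t - \<omega> (\<tau> j)\<close>; the two index sets are disjoint.\<close>
  define \<sigma> where "\<sigma> i = (if i \<le> j then \<tau> i else t)" for i
  have mono: "mono \<sigma>"
  proof (rule monoI)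
    fix i i' :: nat assume "i \<le> i'"
    moreover have "i \<le> j \<Longrightarrow> \<tau> i \<le> t" using monoD[OF \<tau>(1), of i j] t by linarith
    ultimately show "\<sigma> i \<le> \<sigma> i'" using monoD[OF \<tau>(1), of i i'] by (auto simp: \<sigma>_def)
  qed
  have \<tau>0: "0 \<le> \<tau> i" for i using monoD[OF \<tau>(1), of 0 i] \<tau>(2) by simp
  have \<sigma>0: "0 \<le> \<sigma> i" for i using monoD[OF mono, of 0 i] \<tau>(2) by (simp add: \<sigma>_def)
  define X where "X i \<omega> = \<omega> (\<sigma> (Suc i)) - \<omega> (\<sigma> i)" for i and \<omega> :: "real \<Rightarrow> complex"
  have "indep_vars (\<lambda>_. borel) X {..<Suc j}"
    using W mono \<sigma>0[of 0] unfolding brownian_motion_def X_def by blast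
  then have ind: "indep_var (PiM {..<j} (\<lambda>_. borel)) (\<lambda>\<omega>. restrict (\<lambda>i. X i \<omega>) {..<j})
      (PiM {j} (\<lambda>_. borel)) (\<lambda>\<omega>. restrict (\<lambda>i. X i \<omega>) {j})"
    by (rule indep_var_restrict) auto
  \<comment> \<open>The minimum keeps the sum inside the coordinates \<open>{..<j}\<close>, so
    \<open>Y k\<close> is measurable there for every \<open>k\<close>; for \<open>k \<le> j\<close>
    it telescopes to the position at \<open>\<tau> k\<close>.\<close>
  define Y where "Y k (x :: nat \<Rightarrow> complex) = z + (\<Sum>i<min k j. x i)" for k x
  define S where "S = {x \<in> space (PiM {..<j} (\<lambda>_. borel)). norm (Y j x) < \<epsilon> \<and> (\<forall>i\<in>{1..<j}. \<not> norm (Y i x) < \<epsilon>)}"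
  define T where "T = {x \<in> space (PiM {j} (\<lambda>_. borel :: complex measure)). x j \<in> A}"
  have [measurable]: "Y k \<in> borel_measurable (PiM {..<j} (\<lambda>_. borel))" for k
    unfolding Y_def
    by (rule borel_measurable_add[OF borel_measurable_const borel_measurable_sum], rule measurable_component_singleton) auto
  have Sm: "S \<in> sets (PiM {..<j} (\<lambda>_. borel))"
    unfolding S_def by measurable
  have Tm: "T \<in> sets (PiM {j} (\<lambda>_. borel))"
    unfolding T_def using A by measurable
  have tele: "Y k (\<lambda>i\<in>{..<j}. X i \<omega>) = \<omega> (\<tau> k)" if "k \<le> j" "\<omega> 0 = z" for k \<omega>
  proof -
    have "(\<Sum>i<min k j. (\<lambda>i\<in>{..<j}. X i \<omega>) i) = (\<Sum>i<k. \<omega> (\<sigma> (Suc i)) - \<omega> (\<sigma> i))"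
      using that by (intro sum.cong) (auto simp: X_def)
    also have "\<dots> = \<omega> (\<sigma> k) - \<omega> (\<sigma> 0)" by (rule sum_lessThan_telescope)
    finally show ?thesis using that \<tau>(2) by (simp add: Y_def \<sigma>_def)
  qed
  have AE0: "AE \<omega> in W. \<omega> 0 = z" using W by (simp add: brownian_motion_def)
  let ?f = "\<lambda>\<omega>. restrict (\<lambda>i. X i \<omega>) {..<j}" and ?g = "\<lambda>\<omega>. restrict (\<lambda>i. X i \<omega>) {j}"
  have fS: "?f \<omega> \<in> S \<longleftrightarrow> \<omega> \<in> grid_first \<tau> \<epsilon> j" if "\<omega> 0 = z" for \<omega>
    using tele[of _ \<omega>, OF _ that] by (auto simp: S_def grid_first_def space_PiM)
  have gT: "?g \<omega> \<in> T \<longleftrightarrow> \<omega> t - \<omega> (\<tau> j) \<in> A" for \<omega>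
    by (auto simp: T_def X_def \<sigma>_def space_PiM)
  have [measurable]: "(\<lambda>\<omega>. \<omega> (\<tau> j)) \<in> W \<rightarrow>\<^sub>M borel" "(\<lambda>\<omega>. \<omega> t) \<in> W \<rightarrow>\<^sub>M borel"
    using measurable_brownian_motion[OF W] \<tau>0 t order_trans[OF \<tau>0 t] by auto
  note [measurable] = A
  have [measurable]: "{\<omega> \<in> space W. \<omega> \<in> grid_first \<tau> \<epsilon> j} \<in> sets W"
    using W \<tau>0 by (rule sets_grid_first)
  have m1: "?f -` S \<inter> space W \<in> sets W"
    using indep_var_rv1[OF ind] Sm by (rule measurable_sets)
  have m2: "?g -` T \<inter> space W \<in> sets W"
    using indep_var_rv2[OF ind] Tm by (rule measurable_sets)
  have eq: "(\<lambda>x. (?f x, ?g x)) -` (S \<times> T) \<inter> space W = (?f -` S \<inter> space W) \<inter> (?g -` T \<inter> space W)"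
    by auto
  have "measure W {\<omega> \<in> space W. \<omega> \<in> grid_first \<tau> \<epsilon> j \<and> \<omega> t - \<omega> (\<tau> j) \<in> A} =
      measure W ((\<lambda>x. (?f x, ?g x)) -` (S \<times> T) \<inter> space W)"
  proof (rule finite_measure_eq_AE)
    show "AE \<omega> in W. (\<omega> \<in> {\<omega> \<in> space W. \<omega> \<in> grid_first \<tau> \<epsilon> j \<and> \<omega> t - \<omega> (\<tau> j) \<in> A}) =
        (\<omega> \<in> (\<lambda>x. (?f x, ?g x)) -` (S \<times> T) \<inter> space W)"
      using AE0 AE_space by eventually_elim (use fS gT in auto)
    show "{\<omega> \<in> space W. \<omega> \<in> grid_first \<tau> \<epsilon> j \<and> \<omega> t - \<omega> (\<tau> j) \<in> A} \<in> sets W" by measurable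
    show "(\<lambda>x. (?f x, ?g x)) -` (S \<times> T) \<inter> space W \<in> sets W"
      unfolding eq using m1 m2 by (rule sets.Int)
  qed
  also have "\<dots> = prob (?f -` S \<inter> space W) * prob (?g -` T \<inter> space W)"
    using ind Sm Tm by (rule indep_varD)
  also have "prob (?f -` S \<inter> space W) = measure W {\<omega> \<in> space W. \<omega> \<in> grid_first \<tau> \<epsilon> j}"
  proof (rule finite_measure_eq_AE)
    show "AE \<omega> in W. (\<omega> \<in> ?f -` S \<inter> space W) = (\<omega> \<in> {\<omega> \<in> space W. \<omega> \<in> grid_first \<tau> \<epsilon> j})"
      using AE0 AE_space by eventually_elim (use fS in auto)
  qed (use m1 in measurable)
  also have "?g -` T \<inter> space W = {\<omega> \<in> space W. \<omega> t - \<omega> (\<tau> j) \<in> A}" using gT by auto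
  finally show ?thesis .
qed

lemma grid_first_hit:
  "(\<exists>j\<in>{1..n}. norm (\<omega> (\<tau> j)) < \<epsilon>) \<longleftrightarrow> (\<exists>j\<in>{1..n}. \<omega> \<in> grid_first \<tau> \<epsilon> j)"
proof
  assume "\<exists>j\<in>{1..n}. norm (\<omega> (\<tau> j)) < \<epsilon>"
  then obtain j where j: "1 \<le> j" "j \<le> n" "norm (\<omega> (\<tau> j)) < \<epsilon>" by auto
  define k where "k = (LEAST k. 1 \<le> k \<and> norm (\<omega> (\<tau> k)) < \<epsilon>)"
  have "1 \<le> k \<and> norm (\<omega> (\<tau> k)) < \<epsilon>"
    unfolding k_def using j by (intro LeastI[of "\<lambda>k. 1 \<le> k \<and> norm (\<omega> (\<tau> k)) < \<epsilon>" j]) auto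
  moreover have "k \<le> j" unfolding k_def using j by (intro Least_le) auto
  moreover have "\<not> norm (\<omega> (\<tau> i)) < \<epsilon>" if "i \<in> {1..<k}" for i
    using not_less_Least[of i "\<lambda>k. 1 \<le> k \<and> norm (\<omega> (\<tau> k)) < \<epsilon>"] that by (auto simp: k_def)
  ultimately have "k \<in> {1..n}" "\<omega> \<in> grid_first \<tau> \<epsilon> k" using j by (auto simp: grid_first_def)
  then show "\<exists>j\<in>{1..n}. \<omega> \<in> grid_first \<tau> \<epsilon> j" by blast
qed (auto simp: grid_first_def)

lemma grid_first_disjoint:
  "1 \<le> i \<Longrightarrow> 1 \<le> j \<Longrightarrow> \<omega> \<in> grid_first \<tau> \<epsilon> i \<Longrightarrow> \<omega> \<in> grid_first \<tau> \<epsilon> j \<Longrightarrow> i = j"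
  by (rule linorder_cases[of i j]) (auto simp: grid_first_def)

text \<open>Once within \<open>\<epsilon>\<close> of the origin at time \<open>\<tau> j\<close>, the path is within \<open>2 \<epsilon>\<close> at time \<open>t\<close> with probability
  of order \<open>\<epsilon>\<^sup>2 / (t - \<tau> j)\<close>, while the unconditional probability is of order \<open>\<epsilon>\<^sup>2\<close>. Integration over \<open>t\<close>
  yields a factor \<open>ln (1 / \<epsilon>)\<close> against a bounded quantity.\<close>
lemma grid_hit_pointwise:
  fixes z :: complex and \<tau> :: "nat \<Rightarrow> real"
  assumes W: "brownian_motion z W" and \<tau>: "mono \<tau>" "\<tau> 0 = 0"
    and \<epsilon>: "0 < \<epsilon>" and t: "0 < a" "a \<le> t"
  shows "(\<Sum>j=1..n. measure W {\<omega> \<in> space W. \<omega> \<in> grid_first \<tau> \<epsilon> j} *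
      (if t \<in> {\<tau> j + \<epsilon>\<^sup>2..\<tau> j + 1} then 1 / (t - \<tau> j) else 0)) * (exp (- 1 / 2) / 2) \<le> 2 / a"
proof -
  interpret prob_space W using W by (rule brownian_motion_prob_space)
  have \<tau>0: "0 \<le> \<tau> i" for i using monoD[OF \<tau>(1), of 0 i] \<tau>(2) by simp
  have [measurable]: "(\<lambda>\<omega>. \<omega> t) \<in> W \<rightarrow>\<^sub>M borel" "(\<lambda>\<omega>. \<omega> 0) \<in> W \<rightarrow>\<^sub>M borel"
    using measurable_brownian_motion[OF W] t by auto
  have Fm[measurable]: "{\<omega> \<in> space W. \<omega> \<in> grid_first \<tau> \<epsilon> j} \<in> sets W" for j
    using W \<tau>0 by (rule sets_grid_first)
  \<comment> \<open>The \<open>G j\<close> with \<open>j \<ge> 1\<close> are disjoint and all lie in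
    the event that the path is within \<open>2 * \<epsilon>\<close> at time \<open>t\<close>, so
    their probabilities add up to at most the unconditional one. The radius doubles by the triangle
    inequality.\<close>
  define G where "G j = {\<omega> \<in> space W. \<omega> \<in> grid_first \<tau> \<epsilon> j \<and> norm (\<omega> t) < 2 * \<epsilon>}" for j
  have Gm: "G j \<in> sets W" for j unfolding G_def by measurable
  have bound: "measure W {\<omega> \<in> space W. \<omega> \<in> grid_first \<tau> \<epsilon> j} *
      (if t \<in> {\<tau> j + \<epsilon>\<^sup>2..\<tau> j + 1} then 1 / (t - \<tau> j) else 0) * (exp (- 1 / 2) / 2) * \<epsilon>\<^sup>2 \<le> measure W (G j)" for j
  proof (cases "t \<in> {\<tau> j + \<epsilon>\<^sup>2..\<tau> j + 1}")
    case True
    then have tj: "\<tau> j + \<epsilon>\<^sup>2 \<le> t" by simp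
    then have tj': "\<tau> j \<le> t" using zero_le_power2[of \<epsilon>] by linarith
    have "measure W {\<omega> \<in> space W. \<omega> \<in> grid_first \<tau> \<epsilon> j} * (exp (- 1 / 2) * \<epsilon>\<^sup>2 / (2 * (t - \<tau> j)))
      \<le> measure W {\<omega> \<in> space W. \<omega> \<in> grid_first \<tau> \<epsilon> j} * measure W {\<omega> \<in> space W. \<omega> t - \<omega> (\<tau> j) \<in> ball 0 \<epsilon>}"
      using planar_increment_ball_ge[OF W \<tau>0 \<epsilon> tj] by (intro mult_left_mono) auto
    also have "\<dots> = measure W {\<omega> \<in> space W. \<omega> \<in> grid_first \<tau> \<epsilon> j \<and> \<omega> t - \<omega> (\<tau> j) \<in> ball 0 \<epsilon>}"
      by (rule grid_first_indep[OF W \<tau> tj', symmetric]) simp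
    also have "\<dots> \<le> measure W (G j)"
    proof (rule finite_measure_mono[OF _ Gm], safe)
      fix \<omega> assume \<omega>: "\<omega> \<in> space W" "\<omega> \<in> grid_first \<tau> \<epsilon> j" "\<omega> t - \<omega> (\<tau> j) \<in> ball 0 \<epsilon>"
      then have "norm (\<omega> (\<tau> j)) < \<epsilon>" "norm (\<omega> t - \<omega> (\<tau> j)) < \<epsilon>" by (auto simp: grid_first_def)
      then have "norm (\<omega> t) < 2 * \<epsilon>" using norm_triangle_sub[of "\<omega> t" "\<omega> (\<tau> j)"] by linarith
      then show "\<omega> \<in> G j" using \<omega> by (simp add: G_def)
    qed
    finally show ?thesis using True by (simp add: field_simps)
  next
    case False
    then show ?thesis by (simp only: if_False mult_zero_right mult_zero_left measure_nonneg)
  qed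
  have "(\<Sum>j=1..n. measure W {\<omega> \<in> space W. \<omega> \<in> grid_first \<tau> \<epsilon> j} *
      (if t \<in> {\<tau> j + \<epsilon>\<^sup>2..\<tau> j + 1} then 1 / (t - \<tau> j) else 0)) * (exp (- 1 / 2) / 2) * \<epsilon>\<^sup>2
      \<le> (\<Sum>j=1..n. measure W (G j))"
    unfolding sum_distrib_right by (intro sum_mono bound)
  also have "\<dots> = measure W (\<Union>j\<in>{1..n}. G j)"
    using Gm by (intro finite_measure_finite_Union[symmetric])
      (auto simp: disjoint_family_on_def G_def dest: grid_first_disjoint[rotated 2])
  also have "\<dots> \<le> measure W {\<omega> \<in> space W. norm (\<omega> t) < 2 * \<epsilon>}"
    by (intro finite_measure_mono) (auto simp: G_def)
  also have "\<dots> = measure W {\<omega> \<in> space W. \<omega> t - \<omega> 0 \<in> ball (- z) (2 * \<epsilon>)}"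
  proof (rule finite_measure_eq_AE)
    have "AE \<omega> in W. \<omega> 0 = z" using W by (simp add: brownian_motion_def)
    then show "AE \<omega> in W. (\<omega> \<in> {\<omega> \<in> space W. norm (\<omega> t) < 2 * \<epsilon>}) =
       (\<omega> \<in> {\<omega> \<in> space W. \<omega> t - \<omega> 0 \<in> ball (- z) (2 * \<epsilon>)})"
      by eventually_elim (auto simp: dist_norm norm_minus_commute)
    show "{\<omega> \<in> space W. norm (\<omega> t) < 2 * \<epsilon>} \<in> sets W" by measurable
    show "{\<omega> \<in> space W. \<omega> t - \<omega> 0 \<in> ball (- z) (2 * \<epsilon>)} \<in> sets W"
      unfolding mem_ball by measurable
  qed
  also have "\<dots> \<le> (2 * \<epsilon>)\<^sup>2 / (2 * (t - 0))"
    using t \<epsilon> by (intro planar_increment_ball_le[OF W]) auto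
  also have "\<dots> \<le> 2 / a * \<epsilon>\<^sup>2"
    using t \<epsilon> by (simp add: field_simps power2_eq_square mult_left_mono)
  \<comment> \<open>Both sides carry the factor \<open>\<epsilon>\<^sup>2\<close> from the areas of
    the discs; after division the right-hand side no longer depends on \<epsilon>.\<close>
  finally show ?thesis using \<epsilon> by (simp only: mult_le_cancel_right_pos zero_less_power)
qed

text \<open>Integration of \<open>grid_hit_pointwise\<close> over \<open>t\<close>. The right-hand
  side involves neither the number nor the spacing of the grid points, which allows
  refinement.\<close>

lemma grid_hit_bound:
  fixes z :: complex and \<tau> :: "nat \<Rightarrow> real"
  assumes W: "brownian_motion z W" and \<tau>: "mono \<tau>" "\<tau> 0 = 0"
    and ab: "0 < a" "\<And>j. 1 \<le> j \<Longrightarrow> j \<le> n \<Longrightarrow> a \<le> \<tau> j \<and> \<tau> j \<le> b" "a \<le> b" and \<epsilon>: "0 < \<epsilon>" "\<epsilon> < 1"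
  shows "measure W {\<omega> \<in> space W. \<exists>j\<in>{1..n}. norm (\<omega> (\<tau> j)) < \<epsilon>} * ln (1 / \<epsilon>\<^sup>2)
    \<le> 4 * exp (1 / 2) * (b + 1 - a) / a"
proof -
  interpret prob_space W using W by (rule brownian_motion_prob_space)
  have \<tau>0: "0 \<le> \<tau> i" for i using monoD[OF \<tau>(1), of 0 i] \<tau>(2) by simp
  define F where "F j = {\<omega> \<in> space W. \<omega> \<in> grid_first \<tau> \<epsilon> j}" for j
  have Fm: "F j \<in> sets W" for j
    unfolding F_def using W \<tau>0 by (rule sets_grid_first)
  have un: "{\<omega> \<in> space W. \<exists>j\<in>{1..n}. norm (\<omega> (\<tau> j)) < \<epsilon>} = (\<Union>j\<in>{1..n}. F j)"
    unfolding grid_first_hit by (auto simp: F_def)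
  have msum: "measure W (\<Union>j\<in>{1..n}. F j) = (\<Sum>j=1..n. measure W (F j))"
    using Fm by (intro finite_measure_finite_Union)
      (auto simp: disjoint_family_on_def F_def dest: grid_first_disjoint[rotated 2])
  have \<epsilon>2: "\<epsilon>\<^sup>2 \<le> 1" "0 < \<epsilon>\<^sup>2" using \<epsilon> by (auto simp: power_le_one)
  let ?g = "\<lambda>j t. if t \<in> {\<tau> j + \<epsilon>\<^sup>2..\<tau> j + 1} then 1 / (t - \<tau> j) else 0"
  \<comment> \<open>Every \<open>j\<close> contributes the same logarithm, the integral of 1/r over
    \<open>\<epsilon>\<^sup>2 \<le> r \<le> 1\<close>. As \<open>\<tau> j \<le> b\<close>, all these
    windows fit into \<open>{a..b + 1}\<close>.\<close>
  have int: "(?g j has_integral ln (1 / \<epsilon>\<^sup>2)) {a..b + 1}" if j: "j \<in> {1..n}" for j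
  proof -
    have "((\<lambda>t. 1 / (t - \<tau> j)) has_integral ln (\<tau> j + 1 - \<tau> j) - ln (\<tau> j + \<epsilon>\<^sup>2 - \<tau> j)) {\<tau> j + \<epsilon>\<^sup>2..\<tau> j + 1}"
    proof (rule fundamental_theorem_of_calculus)
      fix t assume "t \<in> {\<tau> j + \<epsilon>\<^sup>2..\<tau> j + 1}"
      then have "0 < t - \<tau> j" using \<epsilon>2(2) unfolding atLeastAtMost_iff by linarith
      then show "((\<lambda>t. ln (t - \<tau> j)) has_vector_derivative 1 / (t - \<tau> j)) (at t within {\<tau> j + \<epsilon>\<^sup>2..\<tau> j + 1})"
        by (auto intro!: derivative_eq_intros simp flip: has_real_derivative_iff_has_vector_derivative)
    qed (use \<epsilon>2 in auto)
    then have "((\<lambda>t. 1 / (t - \<tau> j)) has_integral ln (1 / \<epsilon>\<^sup>2)) {\<tau> j + \<epsilon>\<^sup>2..\<tau> j + 1}"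
      using \<epsilon>2 by (simp add: ln_div)
    moreover have "{\<tau> j + \<epsilon>\<^sup>2..\<tau> j + 1} \<subseteq> {a..b + 1}"
      using ab(2)[of j] j by (auto intro: add_increasing2)
    ultimately show ?thesis by (subst has_integral_restrict)
  qed
  have "((\<lambda>t. (\<Sum>j=1..n. measure W (F j) * ?g j t) * (exp (- 1 / 2) / 2)) has_integral
      (\<Sum>j=1..n. measure W (F j) * ln (1 / \<epsilon>\<^sup>2)) * (exp (- 1 / 2) / 2)) {a..b + 1}"
    using int by (intro has_integral_mult_left has_integral_sum has_integral_mult_right) auto
  moreover have "((\<lambda>t. 2 / a) has_integral (b + 1 - a) * (2 / a)) {a..b + 1}"
    using has_integral_const_real[of "2 / a" a "b + 1"] ab by simp
  ultimately have "(\<Sum>j=1..n. measure W (F j) * ln (1 / \<epsilon>\<^sup>2)) * (exp (- 1 / 2) / 2) \<le> (b + 1 - a) * (2 / a)"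
  proof (rule has_integral_le)
    show "(\<Sum>j=1..n. measure W (F j) * ?g j t) * (exp (- 1 / 2) / 2) \<le> 2 / a" if "t \<in> {a..b + 1}" for t
      unfolding F_def using grid_hit_pointwise[OF W \<tau> \<epsilon>(1) ab(1), of t n] that by simp
  qed
  then have "measure W (\<Union>j\<in>{1..n}. F j) * ln (1 / \<epsilon>\<^sup>2) * (exp (- 1 / 2) / 2) \<le> (b + 1 - a) * (2 / a)"
    unfolding msum sum_distrib_right by simp
  then show ?thesis
    unfolding un by (simp add: exp_minus field_simps)
qed

text \<open>With \<epsilon> fixed, continuity puts a path with a zero in \<open>[a, b]\<close>
  within \<epsilon> of the origin on every sufficiently fine grid. The grid bound thus passes to
  \<open>H\<close>, and \<epsilon> tending to 0 leaves no mass.\<close>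

lemma planar_brownian_motion_no_hit_interval:
  fixes z :: complex
  assumes W: "brownian_motion z W" and ab: "0 < a" "a < b"
  shows "emeasure W {\<omega> \<in> space W. \<exists>s\<in>{a..b}. \<omega> s = 0} = 0"
proof -
  interpret prob_space W using W by (rule brownian_motion_prob_space)
  have sW: "space W = space (path_space {0..} UNIV)"
    using sets_brownian_motion[OF W] by (rule sets_eq_imp_space_eq)
  define H where "H = {\<omega> \<in> space W. \<exists>s\<in>{a..b}. \<omega> s = 0}"
  define K where "K = 4 * exp (1 / 2) * (b + 1 - a) / a"
  have Hm: "H \<in> sets W"
    unfolding H_def using ab measurable_brownian_motion[OF W]
    by (intro sets_hits_interval) (auto simp: sW space_path_space intro: continuous_on_subset)
  have main: "measure W H * ln (1 / \<epsilon>\<^sup>2) \<le> K" if \<epsilon>: "0 < \<epsilon>" "\<epsilon> < 1" for \<epsilon>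
  proof -
    have l0: "0 < ln (1 / \<epsilon>\<^sup>2)" using \<epsilon> by (simp add: power_less_one_iff)
    \<comment> \<open>Index 0 is time 0; the equidistant points of \<open>[a, b]\<close> have
      indices 1 to \<open>n + 1\<close>, and the minimum keeps the sequence at \<open>b\<close>
      afterwards. For \<open>n = 0\<close>, division by zero gives the constant \<open>a\<close>
      from index 1 on.\<close>
    define \<tau> where "\<tau> n i = (if i = 0 then 0 else a + (b - a) * real (min (i - 1) n) / real n)" for n i :: nat
    define G where "G n = {\<omega> \<in> space W. \<exists>j\<in>{1..Suc n}. norm (\<omega> (\<tau> n j)) < \<epsilon>}" for n
    have \<tau>mono: "mono (\<tau> n)" for n
      unfolding mono_def \<tau>_def using ab
      by (auto intro!: divide_right_mono mult_left_mono add_nonneg_nonneg)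
    have \<tau>ab: "a \<le> \<tau> n j \<and> \<tau> n j \<le> b" if "1 \<le> j" for n j
    proof -
      have "(b - a) * (real (min (j - 1) n) / real n) \<le> (b - a) * 1"
        using ab by (intro mult_left_mono) (auto simp: divide_le_eq_1)
      then show ?thesis using that ab by (auto simp: \<tau>_def)
    qed
    have \<tau>0: "0 \<le> \<tau> n j" for n j using \<tau>ab[of j n] ab by (cases "j = 0") (auto simp: \<tau>_def)
    have Gm: "G n \<in> sets W" for n
    proof -
      have [measurable]: "(\<lambda>\<omega>. \<omega> (\<tau> n j)) \<in> W \<rightarrow>\<^sub>M borel" for j
        using W \<tau>0 by (rule measurable_brownian_motion)
      show ?thesis unfolding G_def by measurable
    qed
    have G: "measure W (G n) \<le> K / ln (1 / \<epsilon>\<^sup>2)" for n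
    proof -
      have "measure W (G n) * ln (1 / \<epsilon>\<^sup>2) \<le> K"
        unfolding G_def K_def
      proof (rule grid_hit_bound[OF W \<tau>mono _ ab(1) _ _ \<epsilon>])
        show "\<tau> n 0 = 0" by (simp add: \<tau>_def)
      qed (use ab \<tau>ab in auto)
      then show ?thesis using l0 by (simp add: pos_le_divide_eq)
    qed
    \<comment> \<open>A path with a zero meets the event \<open>G n\<close> for all large
      \<open>n\<close>, with a threshold that depends on the path. The sets \<open>D N\<close>
      increase and each is contained in \<open>G N\<close>, so their union inherits the uniform
      bound.\<close>
    define D where "D N = (\<Inter>n\<in>{N..}. G n)" for N
    have Dm: "D N \<in> sets W" for N
      unfolding D_def using Gm by (intro sets.countable_INT') auto
    have "H \<subseteq> (\<Union>N. D N)"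
    proof
      fix \<omega> assume "\<omega> \<in> H"
      then obtain s where s: "\<omega> \<in> space W" "s \<in> {a..b}" "\<omega> s = 0" by (auto simp: H_def)
      have "continuous_on {a..b} \<omega>"
        using s(1) ab by (auto simp: sW space_path_space intro: continuous_on_subset)
      then obtain d where d: "d > 0" "\<And>x. x \<in> {a..b} \<Longrightarrow> dist x s < d \<Longrightarrow> dist (\<omega> x) (\<omega> s) < \<epsilon>"
        using s(2) \<epsilon>(1) unfolding continuous_on_iff by metis
      obtain N :: nat where N: "(b - a) / d < real N" using reals_Archimedean2 by blast
      have "0 < (b - a) / d" using ab d by simp
      then have N0: "0 < real N" using N by linarith
      have "\<omega> \<in> G n" if n: "N \<le> n" for n
      proof -
        have n0: "0 < real n" using N0 n by linarith
        \<comment> \<open>The grid point with index \<open>Suc i\<close> is the last one not after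
          \<open>s\<close>, at distance below \<open>(b - a) / n\<close>.\<close>
        define i where "i = nat \<lfloor>(s - a) * real n / (b - a)\<rfloor>"
        have q0: "0 \<le> (s - a) * real n / (b - a)" using s(2) ab n0 by simp
        have i: "real i \<le> (s - a) * real n / (b - a)" "(s - a) * real n / (b - a) < real i + 1"
          using q0 unfolding i_def by linarith+
        have "(s - a) * real n / (b - a) \<le> real n"
          using s(2) ab n0 by (simp add: field_simps mult_right_mono)
        then have "i \<le> n" using i(1) by linarith
        then have \<tau>i: "\<tau> n (Suc i) = a + (b - a) * real i / real n" by (simp add: \<tau>_def)
        have sa: "s - a = (b - a) * ((s - a) * real n / (b - a)) / real n"
          using n0 ab by simp
        have "(b - a) * real i / real n \<le> s - a"
          by (subst sa) (use i n0 ab in \<open>intro divide_right_mono mult_left_mono; simp\<close>)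
        moreover have "s - a < (b - a) * (real i + 1) / real n"
          by (subst sa) (use i n0 ab in \<open>intro divide_strict_right_mono mult_strict_left_mono; simp\<close>)
        then have "s - a < (b - a) * real i / real n + (b - a) / real n"
          by (simp add: distrib_left add_divide_distrib)
        moreover have "(b - a) / real n < d"
        proof -
          have "(b - a) / d < real n" using N n by linarith
          then show ?thesis using d n0 by (simp add: field_simps)
        qed
        ultimately have "dist (\<tau> n (Suc i)) s < d" unfolding \<tau>i dist_real_def by linarith
        moreover have "\<tau> n (Suc i) \<in> {a..b}" using \<tau>ab[of "Suc i" n] by simp
        ultimately have "norm (\<omega> (\<tau> n (Suc i))) < \<epsilon>" using d(2) s(3) by fastforce
        then show ?thesis using s(1) \<open>i \<le> n\<close> unfolding G_def by (auto intro!: bexI[of _ "Suc i"])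
      qed
      then show "\<omega> \<in> (\<Union>N. D N)" by (auto simp: D_def)
    qed
    then have "measure W H \<le> measure W (\<Union>N. D N)"
      using Dm by (intro finite_measure_mono) auto
    also have "\<dots> \<le> K / ln (1 / \<epsilon>\<^sup>2)"
    proof (rule LIMSEQ_le_const2)
      show "(\<lambda>N. measure W (D N)) \<longlonglongrightarrow> measure W (\<Union>N. D N)"
        using Dm by (intro finite_Lim_measure_incseq) (auto simp: incseq_def D_def)
      show "\<exists>N. \<forall>n\<ge>N. measure W (D n) \<le> K / ln (1 / \<epsilon>\<^sup>2)"
        using Gm by (intro exI[of _ 0] allI impI order_trans[OF finite_measure_mono G]) (auto simp: D_def)
    qed
    finally show ?thesis using l0 by (simp add: pos_le_divide_eq)
  qed
  have K: "0 \<le> K" using ab by (simp add: K_def)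
  have "measure W H = 0"
  proof (rule ccontr)
    assume "measure W H \<noteq> 0"
    then have m: "0 < measure W H" using measure_nonneg[of W H] by linarith
    \<comment> \<open>With \<open>\<epsilon> = exp (- u)\<close> the logarithm is
      \<open>2 * u\<close>, and this \<open>u\<close> makes the left-hand side of
      \<open>main\<close> equal to \<open>2 * K + 2 * measure W H\<close>, which exceeds
      \<open>K\<close>.\<close>
    define u where "u = K / measure W H + 1"
    have u: "0 < u" using K m by (simp add: u_def add_nonneg_pos)
    have "ln (1 / (exp (- u))\<^sup>2) = 2 * u"
      by (simp add: ln_div ln_realpow)
    then have "measure W H * (2 * u) \<le> K" using main[of "exp (- u)"] u by simp
    moreover have "measure W H * (2 * u) = 2 * K + 2 * measure W H"
      using m by (simp add: u_def field_simps)
    ultimately show False using K m by linarith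
  qed
  then show ?thesis unfolding H_def[symmetric] by (simp add: emeasure_eq_measure)
qed

lemma planar_brownian_motion_no_hit:
  fixes z :: complex
  assumes W: "brownian_motion z W"
  shows "emeasure W (hits_within t (space W) 0) = 0"
proof -
  have sW: "space W = space (path_space {0..} UNIV)"
    using sets_brownian_motion[OF W] by (rule sets_eq_imp_space_eq)
  \<comment> \<open>The end point \<open>real n + 2\<close> keeps the interval nondegenerate also
    for \<open>n = 0\<close>, where the left end is 1.\<close>
  define A where "A n = {\<omega> \<in> space W. \<exists>s\<in>{1 / real (Suc n)..real n + 2}. \<omega> s = 0}" for n
  have An: "A n \<in> null_sets W" for n
  proof (rule null_setsI)
    have "1 / real (Suc n) < real n + 2" by (simp add: field_simps add_pos_nonneg)
    then show "emeasure W (A n) = 0"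
      unfolding A_def by (intro planar_brownian_motion_no_hit_interval[OF W]) auto
    show "A n \<in> sets W"
      unfolding A_def sW sets_brownian_motion[OF W] by (rule sets_hits_path_space) (auto intro: order_trans[rotated])
  qed
  have "hits_within t (space W) 0 \<subseteq> (\<Union>n. A n)"
  proof
    fix \<omega> assume "\<omega> \<in> hits_within t (space W) 0"
    then obtain s where s: "\<omega> \<in> space W" "0 < s" "\<omega> s = 0" by (auto simp: hits_within_def)
    obtain n1 where n1: "1 / real (Suc n1) < s" using s(2) by (rule nat_approx_posE)
    obtain n2 where n2: "s < real n2" using reals_Archimedean2 by blast
    have "1 / real (Suc (max n1 n2)) \<le> 1 / real (Suc n1)" by (auto simp: frac_le)
    then have "1 / real (Suc (max n1 n2)) \<le> s" using n1 by linarith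
    moreover have "s \<le> real (max n1 n2) + 2" using n2 by (simp add: max_def)
    ultimately have "\<omega> \<in> A (max n1 n2)" using s by (auto simp: A_def)
    then show "\<omega> \<in> (\<Union>n. A n)" by blast
  qed
  moreover have "(\<Union>n. A n) \<in> null_sets W" using An by (rule null_sets_UN)
  ultimately show ?thesis
    using emeasure_mono[of "hits_within t (space W) 0" "\<Union>n. A n" W]
      null_setsD1[of "\<Union>n. A n" W] null_setsD2[of "\<Union>n. A n" W] by simp
qed

section \<open>The Macdonald function and the scale function\<close>

text \<open>Meant for \<open>u = y * (exp t / 2)\<close>, a lower bound of
  \<open>y * cosh t\<close>: the right-hand side becomes a multiple of
  \<open>exp (- (t / 2)) / sqrt y\<close>, integrable in \<open>t\<close>.\<close>

lemma exp_minus_le_inverse_sqrt: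
  assumes "0 < (u::real)" shows "exp (- u) \<le> 1 / sqrt u"
proof -
  have "u \<le> exp u" using exp_ge_add_one_self[of u] by linarith
  also have "\<dots> \<le> (exp u)\<^sup>2" using assms by (simp add: power2_eq_square)
  finally have "sqrt u \<le> exp u" using real_le_lsqrt[of "exp u" u] by simp
  then show ?thesis using assms by (simp add: exp_minus field_simps)
qed

lemma macdonald_0_eq: "macdonald 0 y = (LINT t|lborel. indicator {0..} t * exp (- y * cosh t))"
  by (simp add: macdonald_def set_lebesgue_integral_def)

lemma has_bochner_integral_exp_half:
  "has_bochner_integral lborel (\<lambda>t. indicator {0..} t * exp (- (t / 2))) (2::real)"
proof (rule has_bochner_integral_nn_integral)
  have "(\<integral>\<^sup>+t. ennreal (exp (- (t / 2))) * indicator {0 ..} t \<partial>lborel) = ennreal (0 - (- 2 * exp (- (0 / 2))))"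
  proof (rule nn_integral_FTC_atLeast)
    show "((\<lambda>t. - 2 * exp (- (t / 2))) \<longlongrightarrow> (0::real)) at_top" by real_asymp
  qed (auto intro!: derivative_eq_intros)
  then show "(\<integral>\<^sup>+t. ennreal (indicator {0..} t * exp (- (t / 2))) \<partial>lborel) = ennreal 2"
    by (simp add: ennreal_mult ennreal_indicator mult.commute)
qed auto

lemma macdonald_0_integrand_le:
  fixes y t :: real
  assumes "0 < y"
  shows "indicator {0..} t * exp (- y * cosh t) \<le> sqrt 2 / sqrt y * (indicator {0..} t * exp (- (t / 2)))"
proof (cases "0 \<le> t")
  case True
  have "exp t / 2 \<le> cosh t" by (simp add: cosh_def)
  then have "exp (- (y * cosh t)) \<le> exp (- (y * (exp t / 2)))"
    using assms by (simp add: mult_left_mono)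
  also have "\<dots> \<le> 1 / sqrt (y * (exp t / 2))"
    using assms by (intro exp_minus_le_inverse_sqrt) auto
  also have "\<dots> = sqrt 2 / sqrt y * exp (- (t / 2))"
  proof -
    have "sqrt (exp t) = exp (t / 2)"
      by (rule real_sqrt_unique) (auto simp: power2_eq_square exp_add[symmetric])
    then show ?thesis by (simp add: real_sqrt_mult real_sqrt_divide exp_minus field_simps)
  qed
  finally show ?thesis using True by simp
qed simp

lemma integrable_macdonald_0:
  fixes y :: real
  assumes "0 < y"
  shows "integrable lborel (\<lambda>t. indicator {0..} t * exp (- y * cosh t))"
proof (rule Bochner_Integration.integrable_bound)
  show "integrable lborel (\<lambda>t. sqrt 2 / sqrt y * (indicator {0..} t * exp (- (t / 2))))"
    using has_bochner_integral_exp_half by (intro integrable_mult_right) (rule integrable.intros)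
  show "AE t in lborel. norm (indicator {0..} t * exp (- y * cosh t)) \<le>
      norm (sqrt 2 / sqrt y * (indicator {0..} t * exp (- (t / 2))))"
    using macdonald_0_integrand_le[OF assms] assms by (intro AE_I2) (simp add: abs_mult)
  have "cosh \<in> borel_measurable (borel :: real measure)"
    by (intro borel_measurable_continuous_onI continuous_intros)
  then show "(\<lambda>t. indicator {0..} t * exp (- y * cosh t)) \<in> borel_measurable lborel"
    by measurable
qed

text \<open>Weaker than the logarithm at 0 and the exponential decay at infinity, but one power
  covers both ends and bounds \<open>y * (macdonald 0 (c * y))\<^sup>2\<close>.\<close>

lemma macdonald_0_le:
  assumes "0 < y"
  shows "macdonald 0 y \<le> 2 * sqrt 2 / sqrt y"
proof -
  have "macdonald 0 y \<le> (LINT t|lborel. sqrt 2 / sqrt y * (indicator {0..} t * exp (- (t / 2))))"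
    unfolding macdonald_0_eq using has_bochner_integral_exp_half
    by (intro integral_mono integrable_macdonald_0 assms macdonald_0_integrand_le
        integrable_mult_right) (rule integrable.intros)
  also have "\<dots> = sqrt 2 / sqrt y * 2"
    using has_bochner_integral_integral_eq[OF has_bochner_integral_exp_half] by simp
  finally show ?thesis by (simp add: mult.commute)
qed

text \<open>Only \<open>[0, T]\<close> is kept, where the integrand is smallest at \<open>T\<close>.
  The choice \<open>T = 1\<close> gives positivity, \<open>T = ln (1 / y)\<close> the logarithmic
  growth at 0.\<close>

lemma macdonald_0_ge:
  assumes "0 < y" "0 \<le> T"
  shows "T * exp (- y * cosh T) \<le> macdonald 0 y"
proof -
  have "T * exp (- y * cosh T) = (LINT t|lborel. exp (- y * cosh T) * indicator {0..T} t)"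
    using assms by simp
  also have "\<dots> \<le> macdonald 0 y"
    unfolding macdonald_0_eq
  proof (rule integral_mono[OF _ integrable_macdonald_0[OF assms(1)]])
    show "integrable lborel (\<lambda>t. exp (- y * cosh T) * indicator {0..T} t)"
      by (intro integrable_mult_right) (simp add: integrable_indicator_iff emeasure_lborel_Icc_eq)
    show "exp (- y * cosh T) * indicator {0..T} t \<le> indicator {0..} t * exp (- y * cosh t)" for t
      using assms by (auto simp: indicator_def cosh_real_nonneg_le_iff)
  qed
  finally show ?thesis .
qed

lemma macdonald_0_pos: "0 < y \<Longrightarrow> 0 < macdonald 0 y"
  using macdonald_0_ge[of y 1] by (rule order_less_le_trans[rotated]) auto

text \<open>At the cutoff \<open>T = ln (1 / y)\<close> one has \<open>y * cosh T \<le> 1\<close>,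
  so the integrand is still at least \<open>exp (- 1)\<close>.\<close>

lemma macdonald_0_ge_ln:
  assumes "0 < y" "y < 1"
  shows "exp (- 1) * ln (1 / y) \<le> macdonald 0 y"
proof -
  have l: "0 \<le> ln (1 / y)" using assms by simp
  have "cosh (ln (1 / y)) \<le> 1 / y"
    using assms l unfolding cosh_def by (simp add: exp_minus ln_div exp_ln field_simps mult_le_one)
  then have "y * cosh (ln (1 / y)) \<le> 1" using assms by (simp add: field_simps)
  then have "exp (- 1) * ln (1 / y) \<le> ln (1 / y) * exp (- y * cosh (ln (1 / y)))"
    using mult_left_mono[of "exp (- 1)" "exp (- y * cosh (ln (1 / y)))" "ln (1 / y)"] l
    by (simp add: mult.commute)
  also have "\<dots> \<le> macdonald 0 y" by (rule macdonald_0_ge[OF assms(1) l])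
  finally show ?thesis .
qed

lemma measurable_macdonald_0 [measurable]: "macdonald 0 \<in> borel_measurable borel"
proof -
  \<comment> \<open>Writing \<open>cosh\<close> through exponentials makes the joint measurability
    of the integrand automatic.\<close>
  have "(\<lambda>y::real. LINT t|lborel. (if 0 \<le> t then exp (- y * ((exp t + exp (- t)) / 2)) else 0)) \<in> borel_measurable borel"
    by measurable
  also have "(\<lambda>y::real. LINT t|lborel. (if 0 \<le> t then exp (- y * ((exp t + exp (- t)) / 2)) else 0)) = macdonald 0"
    unfolding macdonald_0_eq[abs_def]
    by (intro ext Bochner_Integration.integral_cong) (auto simp: cosh_field_def indicator_def)
  finally show ?thesis .
qed

text \<open>Used twice: the speed density is at most 16/c, and the scale density, the reciprocal of
  the left-hand side, is at least c/8.\<close>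

lemma mult_macdonald_0_square_le:
  assumes "0 < c" "0 < y"
  shows "y * (macdonald 0 (c * y))\<^sup>2 \<le> 8 / c"
proof -
  have "(macdonald 0 (c * y))\<^sup>2 \<le> (2 * sqrt 2 / sqrt (c * y))\<^sup>2"
    using assms macdonald_0_le[of "c * y"] macdonald_0_pos[of "c * y"] by (intro power_mono) auto
  also have "\<dots> = 8 / (c * y)" using assms by (simp add: power_mult_distrib power_divide)
  finally show ?thesis using assms by (simp add: field_simps)
qed

section \<open>Finiteness at the origin, continuity and growth of the scale function\<close>

definition scale_density :: "real \<Rightarrow> real \<Rightarrow> real" where
  "scale_density c y = 1 / (y * (macdonald 0 (c * y))\<^sup>2)"

lemma measurable_scale_density [measurable]: "scale_density c \<in> borel_measurable borel"
  unfolding scale_density_def[abs_def] by measurable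

lemma scale_density_ge:
  assumes "0 < c" "0 < y"
  shows "c / 8 \<le> scale_density c y"
proof -
  have "0 < y * (macdonald 0 (c * y))\<^sup>2" using macdonald_0_pos[of "c * y"] assms by simp
  then show ?thesis
    using mult_macdonald_0_square_le[OF assms] assms by (simp add: scale_density_def field_simps)
qed

text \<open>The antiderivative \<open>- 1 / ln (c * y)\<close> tends to 0 at the origin. The end
  point \<open>1 / (2 * c)\<close> stays away from its pole at \<open>1 / c\<close>.\<close>

lemma set_integrable_inverse_ln_square:
  assumes c: "0 < (c::real)"
  shows "set_integrable lborel {0<..<1 / (2 * c)} (\<lambda>y. 1 / (y * (ln (c * y))\<^sup>2))"
proof -
  have "set_integrable lborel (einterval 0 (ereal (1 / (2 * c)))) (\<lambda>y. 1 / (y * (ln (c * y))\<^sup>2))"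
  proof (rule interval_integral_FTC_nonneg(1))
    show "0 < ereal (1 / (2 * c))" using c by simp
    fix y assume "0 < ereal y" "ereal y < ereal (1 / (2 * c))"
    then have y: "0 < y" "c * y < 1 / 2" using c by (auto simp: field_simps)
    then have l: "ln (c * y) < 0" using c by (simp add: ln_less_zero)
    show "DERIV (\<lambda>y. - 1 / ln (c * y)) y :> 1 / (y * (ln (c * y))\<^sup>2)"
      using y l c by (auto intro!: derivative_eq_intros simp: field_simps power2_eq_square)
    show "isCont (\<lambda>y. 1 / (y * (ln (c * y))\<^sup>2)) y"
      using y l c by (auto intro!: continuous_intros)
  next
    show "AE y in lborel. 0 < ereal y \<longrightarrow> ereal y < ereal (1 / (2 * c)) \<longrightarrow> 0 \<le> 1 / (y * (ln (c * y))\<^sup>2)"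
      by auto
    have "((\<lambda>y. - 1 / ln (c * y)) \<longlongrightarrow> 0) (at_right 0)" using c by real_asymp
    then show "(((\<lambda>y. - 1 / ln (c * y)) \<circ> real_of_ereal) \<longlongrightarrow> 0) (at_right 0)"
      by (simp add: zero_ereal_def ereal_tendsto_simps)
    have "((\<lambda>y. - 1 / ln (c * y)) \<longlongrightarrow> - 1 / ln (c * (1 / (2 * c)))) (at_left (1 / (2 * c)))"
      using c by (intro tendsto_intros) auto
    then show "(((\<lambda>y. - 1 / ln (c * y)) \<circ> real_of_ereal) \<longlongrightarrow> - 1 / ln (c * (1 / (2 * c)))) (at_left (ereal (1 / (2 * c))))"
      by (simp only: ereal_tendsto_simps)
  qed
  moreover have "einterval 0 (ereal (1 / (2 * c))) = {0<..<1 / (2 * c)}"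
    by (simp add: zero_ereal_def)
  ultimately show ?thesis by simp
qed

text \<open>This makes the origin accessible: the logarithmic singularity of the Macdonald function
  turns the density into a multiple of \<open>1 / (y * (ln (c * y))\<^sup>2)\<close> at
  worst.\<close>

lemma set_integrable_scale_density:
  assumes c: "0 < c"
  shows "set_integrable lborel {0<..<b} (scale_density c)"
proof -
  define \<delta> where "\<delta> = 1 / (2 * c)"
  have \<delta>: "0 < \<delta>" using c by (simp add: \<delta>_def)
  have 1: "set_integrable lborel {0<..<\<delta>} (scale_density c)"
  proof (rule set_integrable_bound)
    show "set_integrable lborel {0<..<\<delta>} (\<lambda>y. exp 2 * (1 / (y * (ln (c * y))\<^sup>2)))"
      using set_integrable_inverse_ln_square[OF c] unfolding \<delta>_def by (intro set_integrable_mult_right)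
    show "set_borel_measurable lborel {0<..<\<delta>} (scale_density c)"
      unfolding set_borel_measurable_def by measurable
    show "AE y in lborel. y \<in> {0<..<\<delta>} \<longrightarrow>
      norm (scale_density c y) \<le> norm (exp 2 * (1 / (y * (ln (c * y))\<^sup>2)))"
    proof (rule AE_I2, rule impI)
      fix y assume "y \<in> {0<..<\<delta>}"
      then have y: "0 < y" "0 < c * y" "c * y < 1" using c by (auto simp: \<delta>_def field_simps)
      then have l: "ln (c * y) < 0" by (simp add: ln_less_zero)
      have "exp (- 1) * - ln (c * y) \<le> macdonald 0 (c * y)"
        using macdonald_0_ge_ln[OF y(2,3)] y(2) unfolding inverse_eq_divide[symmetric] by (simp only: ln_inverse)
      then have "(exp (- 1) * - ln (c * y))\<^sup>2 \<le> (macdonald 0 (c * y))\<^sup>2"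
        using l by (intro power_mono) (auto simp: mult_nonneg_nonpos)
      moreover have "(exp (- 1) * - ln (c * y))\<^sup>2 = (ln (c * y))\<^sup>2 / exp 2"
        by (simp add: power_mult_distrib exp_minus exp_double[of 1, simplified] divide_inverse power_inverse)
      ultimately have "(ln (c * y))\<^sup>2 / exp 2 \<le> (macdonald 0 (c * y))\<^sup>2" by simp
      then have "y * ((ln (c * y))\<^sup>2 / exp 2) \<le> y * (macdonald 0 (c * y))\<^sup>2"
        using y by (intro mult_left_mono) auto
      then have "scale_density c y \<le> 1 / (y * ((ln (c * y))\<^sup>2 / exp 2))"
        unfolding scale_density_def using y l macdonald_0_pos[OF y(2)] by (intro divide_left_mono mult_pos_pos) (auto intro!: divide_pos_pos)
      moreover have "0 \<le> scale_density c y" using y by (simp add: scale_density_def)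
      ultimately show "norm (scale_density c y) \<le> norm (exp 2 * (1 / (y * (ln (c * y))\<^sup>2)))"
        using y by simp
    qed
  qed
  \<comment> \<open>The bound \<open>macdonald_0_ge\<close> with \<open>T = 1\<close>, at the worst
    point \<open>y = b\<close>.\<close>
  define m where "m = exp (- (c * b) * cosh 1)"
  have 2: "set_integrable lborel {\<delta>..<b} (scale_density c)"
  proof (rule set_integrable_bound)
    show "set_integrable lborel {\<delta>..<b} (\<lambda>_. 1 / (\<delta> * m\<^sup>2))"
      by (rule set_integrable_subset[of _ "{\<delta>..b}"])
        (auto intro!: borel_integrable_atLeastAtMost' continuous_on_const)
    show "set_borel_measurable lborel {\<delta>..<b} (scale_density c)"
      unfolding set_borel_measurable_def by measurable
    show "AE y in lborel. y \<in> {\<delta>..<b} \<longrightarrow> norm (scale_density c y) \<le> norm (1 / (\<delta> * m\<^sup>2))"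
    proof (rule AE_I2, rule impI)
      fix y assume "y \<in> {\<delta>..<b}"
      then have y: "\<delta> \<le> y" "y \<le> b" "0 < y" using \<delta> by auto
      have "m \<le> 1 * exp (- (c * y) * cosh 1)"
        unfolding m_def using y c by simp
      also have "\<dots> \<le> macdonald 0 (c * y)" using y c by (intro macdonald_0_ge) auto
      finally have "m\<^sup>2 \<le> (macdonald 0 (c * y))\<^sup>2" by (intro power_mono) (auto simp: m_def)
      then have "scale_density c y \<le> 1 / (\<delta> * m\<^sup>2)"
        unfolding scale_density_def using y \<delta> by (intro divide_left_mono mult_mono mult_pos_pos)
          (auto simp: m_def intro!: mult_pos_pos dest: order_less_le_trans[rotated])
      moreover have "0 \<le> scale_density c y" using y by (simp add: scale_density_def)
      ultimately show "norm (scale_density c y) \<le> norm (1 / (\<delta> * m\<^sup>2))"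
        using \<delta> by simp
    qed
  qed
  have "set_integrable lborel ({0<..<\<delta>} \<union> {\<delta>..<b}) (scale_density c)"
    using 1 2 by (rule set_integrable_Un) auto
  then show ?thesis
    by (rule set_integrable_subset) auto
qed

lemma scale_density_integrable_on:
  assumes "0 < c"
  shows "scale_density c integrable_on {0..b}"
  using set_borel_integral_eq_integral(1)[OF set_integrable_scale_density[OF assms]]
  by (simp add: integrable_on_open_interval_real)

text \<open>The gauge integral over closed intervals brings additivity and the continuity of
  indefinite integrals; for negative \<open>x\<close> both sides are 0.\<close>

lemma bes_scale_eq:
  assumes "0 < \<beta>"
  shows "bes_scale \<beta> x = integral {0..x} (scale_density (sqrt (2 * \<beta>)))"
proof -
  have "bes_scale \<beta> x = integral {0<..<x} (scale_density (sqrt (2 * \<beta>)))"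
    unfolding bes_scale_def scale_density_def[symmetric]
    using assms by (intro set_borel_integral_eq_integral(2) set_integrable_scale_density) auto
  then show ?thesis by (simp add: integral_open_interval_real)
qed

lemma bes_scale_0 [simp]: "bes_scale \<beta> 0 = 0"
  by (simp add: bes_scale_def set_lebesgue_integral_def)

lemma continuous_on_bes_scale:
  assumes "0 < \<beta>" shows "continuous_on {0..b} (bes_scale \<beta>)"
  using indefinite_integral_continuous_1[OF scale_density_integrable_on, of "sqrt (2 * \<beta>)" b] assms
  by (simp add: bes_scale_eq cong: continuous_on_cong)

text \<open>Linear growth yields strict monotonicity, and also unboundedness: high levels are then
  reached before the origin with vanishing probability.\<close>

lemma bes_scale_diff_ge:
  assumes \<beta>: "0 < \<beta>" and ab: "0 \<le> a" "a \<le> b"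
  shows "sqrt (2 * \<beta>) / 8 * (b - a) \<le> bes_scale \<beta> b - bes_scale \<beta> a"
proof -
  define c where "c = sqrt (2 * \<beta>)"
  have c: "0 < c" using \<beta> by (simp add: c_def)
  have i: "scale_density c integrable_on {a..b}"
    using scale_density_integrable_on[OF c, of b] by (rule integrable_on_subinterval) (use ab in auto)
  have "bes_scale \<beta> b - bes_scale \<beta> a = integral {a..b} (scale_density c)"
    unfolding bes_scale_eq[OF \<beta>] c_def[symmetric]
    using Henstock_Kurzweil_Integration.integral_combine[OF ab scale_density_integrable_on[OF c]] by linarith
  \<comment> \<open>The open interval avoids \<open>y = 0\<close>, where division by zero makes the
    density 0 and the lower bound fails.\<close>
  also have "\<dots> = integral {a<..<b} (scale_density c)" by (simp add: integral_open_interval_real)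
  also have "\<dots> \<ge> integral {a<..<b} (\<lambda>_. c / 8)"
  proof (rule integral_le)
    show "(\<lambda>_. c / 8) integrable_on {a<..<b}" by (simp add: integrable_on_open_interval_real integrable_const_ivl)
    show "scale_density c integrable_on {a<..<b}" using i by (simp add: integrable_on_open_interval_real)
    show "c / 8 \<le> scale_density c y" if "y \<in> {a<..<b}" for y
      using scale_density_ge[OF c, of y] that ab by simp
  qed
  also have "integral {a<..<b} (\<lambda>_. c / 8) = c / 8 * (b - a)"
    using ab by (simp add: integral_open_interval_real[symmetric])
  finally show ?thesis by (simp add: c_def)
qed

lemma bes_scale_strict_mono:
  assumes "0 < \<beta>" "0 \<le> a" "a < b"
  shows "bes_scale \<beta> a < bes_scale \<beta> b"
proof -
  have "0 < sqrt (2 * \<beta>) / 8 * (b - a)" using assms by simp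
  then show ?thesis using bes_scale_diff_ge[of \<beta> a b] assms by linarith
qed

text \<open>\<open>f\<close> stands for a Green function bounded by \<open>q\<close>, and 16/c
  bounds the speed density.\<close>

lemma nn_integral_bes_speed_le:
  assumes \<beta>: "0 < \<beta>" and a: "0 \<le> a" "a \<le> b" and q: "0 \<le> q"
    and f: "f \<in> borel_measurable borel" "\<And>y. y \<in> A \<Longrightarrow> f y \<le> q"
    and A: "A \<in> sets borel" "A \<subseteq> {a..b}"
  shows "(\<integral>\<^sup>+y\<in>A. ennreal (f y) \<partial>bes_speed \<beta>) \<le> ennreal (q * (16 / sqrt (2 * \<beta>)) * (b - a))"
proof -
  define c where "c = sqrt (2 * \<beta>)"
  have c: "0 < c" using \<beta> by (simp add: c_def)
  note [measurable] = f(1) A(1)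
  have "(\<integral>\<^sup>+y\<in>A. ennreal (f y) \<partial>bes_speed \<beta>) =
     (\<integral>\<^sup>+y. ennreal (2 * y * (macdonald 0 (c * y))\<^sup>2) * indicator {0<..} y * (ennreal (f y) * indicator A y) \<partial>lborel)"
    unfolding bes_speed_def c_def[symmetric] by (subst nn_integral_density) auto
  also have "\<dots> \<le> (\<integral>\<^sup>+y. ennreal (q * (16 / c)) * indicator {a..b} y \<partial>lborel)"
  proof (rule nn_integral_mono)
    fix y
    show "ennreal (2 * y * (macdonald 0 (c * y))\<^sup>2) * indicator {0<..} y * (ennreal (f y) * indicator A y)
      \<le> ennreal (q * (16 / c)) * indicator {a..b} y"
    proof (cases "0 < y \<and> y \<in> A")
      case True
      then have "ennreal (2 * y * (macdonald 0 (c * y))\<^sup>2) * ennreal (f y) \<le> ennreal (16 / c) * ennreal q"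
        using mult_macdonald_0_square_le[OF c, of y] f(2)[of y] by (intro mult_mono ennreal_leI) auto
      also have "\<dots> = ennreal (q * (16 / c))" using q c by (simp add: ennreal_mult[symmetric] mult.commute)
      finally show ?thesis using True A by auto
    qed auto
  qed
  also have "\<dots> = ennreal (q * (16 / c) * (b - a))"
    using a q c by (simp add: nn_integral_cmult_indicator ennreal_mult[symmetric])
  finally show ?thesis by (simp add: c_def)
qed

section \<open>Hitting times of the diffusion\<close>

lemma hitting_time_le_iff:
  fixes y :: "'a::metric_space"
  assumes \<omega>: "continuous_on {0..} \<omega>" and r: "0 \<le> r"
  shows "hitting_time y \<omega> \<le> ennreal r \<longleftrightarrow> (\<exists>s\<in>{0..r}. \<omega> s = y)"
proof
  assume "\<exists>s\<in>{0..r}. \<omega> s = y"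
  then obtain s where s: "0 \<le> s" "s \<le> r" "\<omega> s = y" by auto
  then have "hitting_time y \<omega> \<le> ennreal s"
    unfolding hitting_time_def by (intro Inf_lower) auto
  also have "\<dots> \<le> ennreal r" using s by (intro ennreal_leI)
  finally show "hitting_time y \<omega> \<le> ennreal r" .
next
  assume le: "hitting_time y \<omega> \<le> ennreal r"
  \<comment> \<open>The margin 1 makes the inequality for the infimum strict, which yields some time
    in \<open>A\<close>. Compactness then gives a first such time, and it is at most
    \<open>r\<close>.\<close>
  define A where "A = {0..r + 1} \<inter> \<omega> -` {y}"
  have "continuous_on {0..r + 1} \<omega>" using \<omega> by (rule continuous_on_subset) auto
  then have "closed A" unfolding A_def by (rule continuous_closed_preimage) auto
  then have "compact ({0..r + 1} \<inter> A)" by (rule compact_Int_closed[OF compact_Icc])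
  then have "compact A" by (simp add: A_def)
  have "hitting_time y \<omega> < ennreal (r + 1)"
    by (rule order_le_less_trans[OF le]) (simp add: ennreal_less_iff r)
  then obtain t where t: "0 \<le> t" "\<omega> t = y" "ennreal t < ennreal (r + 1)"
    unfolding hitting_time_def Inf_less_iff by auto
  then have "t \<in> A" by (auto simp: A_def ennreal_less_iff)
  with \<open>compact A\<close> obtain m where m: "m \<in> A" "\<And>t. t \<in> A \<Longrightarrow> m \<le> t"
    using compact_attains_inf[of A] by blast
  have "ennreal m \<le> hitting_time y \<omega>"
    unfolding hitting_time_def
  proof (rule Inf_greatest, clarify)
    fix t assume "0 \<le> t" "y = \<omega> t"
    then show "ennreal m \<le> ennreal t"
      using m by (cases "t \<le> r + 1") (auto simp: A_def intro!: ennreal_leI)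
  qed
  with le have "ennreal m \<le> ennreal r" by (rule order_trans[rotated])
  then have "m \<le> r" using r by (simp add: ennreal_le_iff)
  with m(1) show "\<exists>s\<in>{0..r}. \<omega> s = y" by (auto simp: A_def)
qed

lemma hitting_time_attained:
  fixes y :: "'a::metric_space"
  assumes \<omega>: "continuous_on {0..} \<omega>" and "hitting_time y \<omega> < \<infinity>"
  shows "\<omega> (enn2real (hitting_time y \<omega>)) = y"
proof -
  define r where "r = enn2real (hitting_time y \<omega>)"
  have r: "0 \<le> r" "hitting_time y \<omega> = ennreal r" using assms by (auto simp: r_def)
  obtain s where s: "0 \<le> s" "s \<le> r" "\<omega> s = y"
    using hitting_time_le_iff[OF \<omega> r(1), of y] r(2) by auto
  then have "hitting_time y \<omega> \<le> ennreal s"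
    unfolding hitting_time_def by (intro Inf_lower) auto
  then have "r \<le> s" using r s by (simp add: ennreal_le_iff)
  with s show ?thesis by (simp add: r_def[symmetric])
qed

lemma continuous_on_path_space: "\<omega> \<in> space (path_space {0..} E) \<Longrightarrow> continuous_on {0..} \<omega>"
  by (simp add: space_path_space)

text \<open>Since the infimum is attained, the event is decided by the coordinates up to
  \<open>r\<close>, without a look beyond \<open>r\<close>.\<close>

lemma sets_coord_filtration_hits:
  fixes y :: "'a::metric_space"
  assumes "0 \<le> r"
  shows "{\<omega> \<in> space (path_space {0..} E). hitting_time y \<omega> \<le> ennreal r} \<in> sets (coord_filtration E (ennreal r))"
proof -
  have "{\<omega> \<in> space (path_space {0..} E). hitting_time y \<omega> \<le> ennreal r} =
      {\<omega> \<in> space (coord_filtration E (ennreal r)). \<exists>s\<in>{0..r}. \<omega> s = y}"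
    unfolding space_coord_filtration
    using hitting_time_le_iff[OF continuous_on_path_space assms] by blast
  also have "\<dots> \<in> sets (coord_filtration E (ennreal r))"
  proof (rule sets_hits_interval)
    show "continuous_on {0..r} \<omega>" if "\<omega> \<in> space (coord_filtration E (ennreal r))" for \<omega>
      using that by (auto simp: space_coord_filtration space_path_space intro: continuous_on_subset)
    show "(\<lambda>\<omega>. \<omega> q) \<in> borel_measurable (coord_filtration E (ennreal r))" if "q \<in> {0..r}" for q
    proof (rule measurableI)
      fix B :: "'a set" assume "B \<in> sets borel"
      then show "(\<lambda>\<omega>. \<omega> q) -` B \<inter> space (coord_filtration E (ennreal r)) \<in> sets (coord_filtration E (ennreal r))"
        using that unfolding space_coord_filtration unfolding coord_filtration_def
        by (intro in_measure_of) (auto intro!: ennreal_leI)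
    qed simp
  qed
  finally show ?thesis .
qed

lemma coord_filtration_subset_path_space: "sets (coord_filtration E t) \<subseteq> sets (path_space {0..} E)"
  unfolding coord_filtration_def
  by (subst sets_measure_of, blast, rule sets.sigma_sets_subset) (auto intro!: measurable_sets[OF measurable_path_space_component])

lemma coord_le_right_filtration: "sets (coord_filtration E t) \<subseteq> sets (right_filtration E t)"
proof -
  have "sets (coord_filtration E t) \<subseteq> sets (coord_filtration E u)" if "t \<le> u" for u
    unfolding coord_filtration_def
    by (rule sigma_le_sets[THEN iffD2, OF _ ]) (use that in \<open>auto intro: order_trans\<close>)
  then show ?thesis
    unfolding sets_right_filtration by (intro INT_greatest) (metis insertE greaterThan_iff less_imp_le top_greatest infinity_ennreal_def)
qed

lemma stopping_time_hitting_time: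
  fixes y :: "'a::metric_space"
  shows "stopping_time (right_filtration E) (hitting_time y)"
proof (rule stopping_timeI)
  fix t :: ennreal
  have sp: "space (right_filtration E t) = space (path_space {0..} E)"
    using filtration_right_filtration[of E] by (rule filtration.space_F)
  show "Measurable.pred (right_filtration E t) (\<lambda>\<omega>. hitting_time y \<omega> \<le> t)"
  proof (cases t)
    case (real r)
    then have "{\<omega> \<in> space (right_filtration E t). hitting_time y \<omega> \<le> t} \<in> sets (right_filtration E t)"
      using sets_coord_filtration_hits[of r E y] coord_le_right_filtration[of E t] sp by auto
    then show ?thesis by (simp add: pred_def)
  qed simp
qed

lemma measurable_hitting_time [measurable]:
  fixes y :: "'a::metric_space"
  shows "hitting_time y \<in> borel_measurable (path_space {0..} E)"
proof (rule borel_measurableI_le)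
  fix t :: ennreal
  show "{\<omega> \<in> space (path_space {0..} E). hitting_time y \<omega> \<le> t} \<in> sets (path_space {0..} E)"
  proof (cases t)
    case (real r)
    then show ?thesis
      using sets_coord_filtration_hits[of r E y] coord_filtration_subset_path_space by blast
  qed simp
qed

lemma strong_markov_prob_space:
  "strong_markov_family E P \<Longrightarrow> x \<in> E \<Longrightarrow> prob_space (P x)"
  "strong_markov_family E P \<Longrightarrow> x \<in> E \<Longrightarrow> sets (P x) = sets (path_space {0..} E)"
proof -
  assume "strong_markov_family E P" "x \<in> E"
  then have "P x \<in> space (prob_algebra (path_space {0..} E))"
    unfolding strong_markov_family_def
    by (intro measurable_space[of P "restrict_space borel E"]) (auto simp: space_restrict_space)
  then show "prob_space (P x)" "sets (P x) = sets (path_space {0..} E)"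
    by (simp_all add: space_prob_algebra)
qed

text \<open>At a finite hitting time the path sits at \<open>y\<close>, so the integrand in the
  strong Markov property is constant and factors out. The bound \<open>a\<close> may be \<infinity>,
  hence the separate finiteness condition.\<close>

lemma strong_markov_hitting_time:
  fixes E :: "'a::metric_space set"
  assumes P: "strong_markov_family E P" and x: "x \<in> E" and B: "B \<in> sets (path_space {0..} E)"
  shows "emeasure (P x) {\<omega> \<in> space (path_space {0..} E). hitting_time y \<omega> \<le> a \<and> hitting_time y \<omega> < \<infinity> \<and>
       path_shift (enn2real (hitting_time y \<omega>)) \<omega> \<in> B} =
    emeasure (P y) B * emeasure (P x) {\<omega> \<in> space (path_space {0..} E). hitting_time y \<omega> \<le> a \<and> hitting_time y \<omega> < \<infinity>}"
proof -
  let ?S = "path_space {0..} E" and ?T = "hitting_time y"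
  have sets: "sets (P x) = sets ?S" using P x by (rule strong_markov_prob_space)
  define A where "A = {\<omega> \<in> space ?S. ?T \<omega> \<le> a}"
  interpret filtration "space ?S" "right_filtration E" by (rule filtration_right_filtration)
  have st: "stopping_time (right_filtration E) ?T" by (rule stopping_time_hitting_time)
  \<comment> \<open>Intersected with \<open>?T \<omega> \<le> t\<close>, the set \<open>A\<close>
    becomes \<open>?T \<omega> \<le> min a t\<close>.\<close>
  have "A \<in> sets (pre_sigma ?T)"
  proof (rule sets_pre_sigmaI[OF st])
    fix t
    have "{\<omega> \<in> space (right_filtration E (min a t)). ?T \<omega> \<le> min a t} \<in> sets (right_filtration E (min a t))"
      using stopping_timeD[OF st] by (rule predE)
    then have "{\<omega> \<in> A. ?T \<omega> \<le> t} \<in> sets (right_filtration E (min a t))"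
      by (simp add: A_def conj_assoc space_F)
    then show "{\<omega> \<in> A. ?T \<omega> \<le> t} \<in> sets (right_filtration E t)"
      using sets_F_mono[of "min a t" t] by auto
  qed
  then have "emeasure (P x) {\<omega>\<in>A. ?T \<omega> < \<infinity> \<and> path_shift (enn2real (?T \<omega>)) \<omega> \<in> B} =
       (\<integral>\<^sup>+\<omega>\<in>{\<omega>\<in>A. ?T \<omega> < \<infinity>}. emeasure (P (\<omega> (enn2real (?T \<omega>)))) B \<partial>P x)"
    using P x B st unfolding strong_markov_family_def by blast
  also have "\<dots> = (\<integral>\<^sup>+\<omega>. emeasure (P y) B * indicator {\<omega>\<in>A. ?T \<omega> < \<infinity>} \<omega> \<partial>P x)"
    by (intro nn_integral_cong)
       (auto simp: indicator_def A_def hitting_time_attained[OF continuous_on_path_space])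
  also have "\<dots> = emeasure (P y) B * emeasure (P x) {\<omega>\<in>A. ?T \<omega> < \<infinity>}"
  proof (rule nn_integral_cmult_indicator)
    show "{\<omega>\<in>A. ?T \<omega> < \<infinity>} \<in> sets (P x)" unfolding sets A_def by measurable
  qed
  finally show ?thesis by (simp add: A_def conj_assoc)
qed


section \<open>The diffusion: estimates from scale function and speed measure\<close>

locale bes_down_diffusion =
  fixes \<beta> :: real and X :: "real \<Rightarrow> (real \<Rightarrow> real) measure"
  assumes \<beta>_pos: "0 < \<beta>" and bes_down: "bes_down \<beta> X"
begin

abbreviation S :: "(real \<Rightarrow> real) measure" where "S \<equiv> path_space {0..} {0..}"
abbreviation s :: "real \<Rightarrow> real" where "s \<equiv> bes_scale \<beta>"

lemma strong_markov: "strong_markov_family {0..} X"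
  using bes_down by (simp add: bes_down_def)

lemma prob_space_X: "0 \<le> x \<Longrightarrow> prob_space (X x)"
  using strong_markov_prob_space(1)[OF strong_markov] by simp

lemma sets_X: "0 \<le> x \<Longrightarrow> sets (X x) = sets S"
  using strong_markov_prob_space(2)[OF strong_markov] by simp

lemma space_X: "0 \<le> x \<Longrightarrow> space (X x) = space S"
  using sets_X sets_eq_imp_space_eq by blast

lemma measurable_hitting_time_X: "0 \<le> x \<Longrightarrow> hitting_time y \<in> borel_measurable (X x)"
  using measurable_hitting_time measurable_cong_sets[OF sets_X refl] by blast

lemma AE_start: "0 \<le> x \<Longrightarrow> AE \<omega> in X x. \<omega> 0 = x"
  using strong_markov by (simp add: strong_markov_family_def)

text \<open>Monotonicity on the whole line, with value 0 on the negative half, gives the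
  measurability of \<open>s\<close> needed for integrals against the speed measure.\<close>

lemma mono_s: "mono s"
proof (rule monoI)
  fix x y :: real assume "x \<le> y"
  consider "x < 0" "y < 0" | "x < 0" "0 \<le> y" | "0 \<le> x" by linarith
  then show "s x \<le> s y"
  proof cases
    case 1
    then show ?thesis by (simp add: bes_scale_eq[OF \<beta>_pos])
  next
    case 2
    then show ?thesis using bes_scale_strict_mono[OF \<beta>_pos, of 0 y]
      by (cases "y = 0") (simp_all add: bes_scale_eq[OF \<beta>_pos, of x])
  next
    case 3
    then show ?thesis using bes_scale_strict_mono[OF \<beta>_pos, of x y] \<open>x \<le> y\<close> by (cases "x = y") simp_all
  qed
qed

lemma measurable_s [measurable]: "s \<in> borel_measurable borel"
  using mono_s by (rule borel_measurable_mono)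

definition speed_bound :: real where "speed_bound = 16 / sqrt (2 * \<beta>)"

lemma speed_bound_pos: "0 < speed_bound"
  using \<beta>_pos by (simp add: speed_bound_def)

lemma exit_prob:
  assumes "0 \<le> a" "a < x" "x < b"
  shows "measure (X x) {\<omega> \<in> space S. hitting_time b \<omega> < hitting_time a \<omega>} = (s x - s a) / (s b - s a)"
  using bes_down assms unfolding bes_down_def has_scale_function_def by (simp add: space_X)

text \<open>The Green function is at most \<open>s x - s a\<close>: its upper factor divided by
  \<open>s b - s a\<close> is at most 1. The asymmetric form is small when \<open>x\<close> is close
  to \<open>a\<close> in scale.\<close>

lemma mean_exit_time_le:
  assumes "0 \<le> a" "a < x" "x < b"
  shows "(\<integral>\<^sup>+\<omega>. min (hitting_time a \<omega>) (hitting_time b \<omega>) \<partial>X x) \<le>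
    ennreal ((s x - s a) * speed_bound * (b - a))"
proof -
  have ab: "s a < s x" "s x < s b"
    using assms by (auto intro!: bes_scale_strict_mono \<beta>_pos)
  have "(\<integral>\<^sup>+\<omega>. min (hitting_time a \<omega>) (hitting_time b \<omega>) \<partial>X x) =
      (\<integral>\<^sup>+y\<in>{a<..<b}. ennreal ((s (min x y) - s a) * (s b - s (max x y)) / (s b - s a)) \<partial>bes_speed \<beta>)"
    using bes_down assms unfolding bes_down_def has_speed_measure_def by blast
  also have "\<dots> \<le> ennreal ((s x - s a) * speed_bound * (b - a))"
    unfolding speed_bound_def
  proof (rule nn_integral_bes_speed_le[OF \<beta>_pos assms(1)])
    fix y assume y: "y \<in> {a<..<b}"
    have "s (min x y) - s a \<le> s x - s a" "0 \<le> s (min x y) - s a"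
      "s b - s (max x y) \<le> s b - s a" "0 \<le> s b - s (max x y)"
      using y assms by (auto intro!: monoD[OF mono_s])
    then have "(s (min x y) - s a) * (s b - s (max x y)) \<le> (s x - s a) * (s b - s a)"
      using ab by (intro mult_mono) auto
    then show "(s (min x y) - s a) * (s b - s (max x y)) / (s b - s a) \<le> s x - s a"
      using ab by (simp add: pos_divide_le_eq)
  qed (use assms ab in auto)
  finally show ?thesis .
qed

lemma mean_hitting_time_from_0_le:
  assumes "0 < b"
  shows "(\<integral>\<^sup>+\<omega>. hitting_time b \<omega> \<partial>X 0) \<le> ennreal (s b * speed_bound * b)"
proof -
  have sb: "0 < s b" using bes_scale_strict_mono[OF \<beta>_pos, of 0 b] assms by simp
  have "(\<integral>\<^sup>+\<omega>. hitting_time b \<omega> \<partial>X 0) = (\<integral>\<^sup>+y\<in>{0..<b}. ennreal (s b - s (max 0 y)) \<partial>bes_speed \<beta>)"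
    using bes_down assms unfolding bes_down_def has_speed_measure_def by blast
  also have "\<dots> \<le> ennreal (s b * speed_bound * (b - 0))"
    unfolding speed_bound_def
  proof (rule nn_integral_bes_speed_le[OF \<beta>_pos])
    fix y assume y: "y \<in> {0..<b}"
    show "s b - s (max 0 y) \<le> s b"
      using monoD[OF mono_s, of 0 "max 0 y"] by simp
  qed (use assms sb in auto)
  finally show ?thesis by simp
qed

section \<open>From exit estimates to visits of the origin\<close>

lemma exit_complement:
  assumes "0 \<le> a" "a < x" "x < b"
  shows "emeasure (X x) {\<omega> \<in> space S. hitting_time a \<omega> \<le> hitting_time b \<omega>} =
    ennreal (1 - (s x - s a) / (s b - s a))"
proof -
  interpret prob_space "X x" using assms by (intro prob_space_X) auto
  have [measurable]: "hitting_time y \<in> borel_measurable (X x)" for y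
    using assms by (intro measurable_hitting_time_X) auto
  have sp: "space S = space (X x)" using assms by (intro space_X[symmetric]) auto
  \<comment> \<open>Ties, and with them paths that hit neither point, are counted on the side of
    \<open>a\<close>.\<close>
  have "{\<omega> \<in> space S. hitting_time a \<omega> \<le> hitting_time b \<omega>} =
      space (X x) - {\<omega> \<in> space S. hitting_time b \<omega> < hitting_time a \<omega>}"
    by (auto simp: sp)
  moreover have "{\<omega> \<in> space S. hitting_time b \<omega> < hitting_time a \<omega>} \<in> sets (X x)"
    unfolding sp by measurable
  ultimately show ?thesis
    using exit_prob[OF assms] prob_compl by (simp add: emeasure_eq_measure)
qed

text \<open>If \<open>a\<close> were almost surely not hit by time \<open>t\<close>, the exit time
  would exceed \<open>t\<close> whenever \<open>b\<close> does not come first, so its mean would be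
  at least \<open>t\<close> times that probability. This contradicts
  \<open>mean_exit_time_le\<close>.\<close>

lemma hit_lower_pos:
  assumes ax: "0 \<le> a" "a < x" "x < b"
    and t: "(s x - s a) * speed_bound * (b - a) < t * (1 - (s x - s a) / (s b - s a))" "0 \<le> t"
  shows "0 < emeasure (X x) {\<omega> \<in> space S. hitting_time a \<omega> \<le> ennreal t}"
proof (rule ccontr)
  assume "\<not> 0 < emeasure (X x) {\<omega> \<in> space S. hitting_time a \<omega> \<le> ennreal t}"
  then have z: "emeasure (X x) {\<omega> \<in> space S. hitting_time a \<omega> \<le> ennreal t} = 0" by simp
  have [measurable]: "hitting_time y \<in> borel_measurable (X x)" for y
    using ax by (intro measurable_hitting_time_X) auto
  have sp: "space S = space (X x)" using ax by (intro space_X[symmetric]) auto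
  let ?C = "{\<omega> \<in> space S. hitting_time a \<omega> \<le> hitting_time b \<omega>}"
  have "{\<omega> \<in> space S. hitting_time a \<omega> \<le> ennreal t} \<in> sets (X x)" unfolding sp by measurable
  then have AE: "AE \<omega> in X x. ennreal t < hitting_time a \<omega>"
    using z by (intro AE_I[of _ _ "{\<omega> \<in> space S. hitting_time a \<omega> \<le> ennreal t}"]) (auto simp: sp not_less)
  have "ennreal (t * (1 - (s x - s a) / (s b - s a))) = ennreal t * emeasure (X x) ?C"
    using t by (simp add: exit_complement[OF ax] ennreal_mult')
  also have "\<dots> = (\<integral>\<^sup>+\<omega>. ennreal t * indicator ?C \<omega> \<partial>X x)"
    unfolding sp by (subst nn_integral_cmult_indicator) auto
  also have "\<dots> \<le> (\<integral>\<^sup>+\<omega>. min (hitting_time a \<omega>) (hitting_time b \<omega>) \<partial>X x)"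
    using AE by (intro nn_integral_mono_AE, eventually_elim) (auto simp: indicator_def min_def)
  also have "\<dots> \<le> ennreal ((s x - s a) * speed_bound * (b - a))"
    using ax by (rule mean_exit_time_le)
  finally have "t * (1 - (s x - s a) / (s b - s a)) \<le> (s x - s a) * speed_bound * (b - a)"
    using ax speed_bound_pos bes_scale_strict_mono[OF \<beta>_pos, of a x] by (subst (asm) ennreal_le_iff) auto
  with t show False by linarith
qed

text \<open>Going to \<open>y\<close> and from there to 0, the probabilities multiply.
  \<open>G\<close> is left general because it is used for a time bound and for
  \<open>hits_within\<close> with finite and infinite horizon; the hypothesis is almost sure so that
  the starting value can enter.\<close>

lemma hit_chain:
  assumes x: "0 \<le> x" and y: "0 \<le> y" and G: "G \<in> sets S"
    and AE: "AE \<omega> in X x. \<omega> \<in> space S \<longrightarrow> (\<forall>r w. 0 \<le> r \<longrightarrow> 0 \<le> w \<longrightarrow> ennreal r \<le> a \<longrightarrow> ennreal w \<le> v \<longrightarrow>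
      \<omega> r = y \<longrightarrow> \<omega> (r + w) = 0 \<longrightarrow> \<omega> \<in> G)"
  shows "emeasure (X y) {\<omega> \<in> space S. hitting_time 0 \<omega> \<le> v \<and> hitting_time 0 \<omega> < \<infinity>} *
    emeasure (X x) {\<omega> \<in> space S. hitting_time y \<omega> \<le> a \<and> hitting_time y \<omega> < \<infinity>} \<le> emeasure (X x) G"
proof -
  let ?B = "{\<omega> \<in> space S. hitting_time 0 \<omega> \<le> v \<and> hitting_time 0 \<omega> < \<infinity>}"
  have B: "?B \<in> sets S" by measurable
  have "emeasure (X y) ?B * emeasure (X x) {\<omega> \<in> space S. hitting_time y \<omega> \<le> a \<and> hitting_time y \<omega> < \<infinity>} =
      emeasure (X x) {\<omega> \<in> space S. hitting_time y \<omega> \<le> a \<and> hitting_time y \<omega> < \<infinity> \<and>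
       path_shift (enn2real (hitting_time y \<omega>)) \<omega> \<in> ?B}"
    using x B by (intro strong_markov_hitting_time[OF strong_markov, symmetric]) auto
  also have "\<dots> \<le> emeasure (X x) G"
  proof (rule emeasure_mono_AE)
    show "G \<in> sets (X x)" using G x by (simp add: sets_X)
    show "AE \<omega> in X x. \<omega> \<in> {\<omega> \<in> space S. hitting_time y \<omega> \<le> a \<and> hitting_time y \<omega> < \<infinity> \<and>
       path_shift (enn2real (hitting_time y \<omega>)) \<omega> \<in> ?B} \<longrightarrow> \<omega> \<in> G"
      using AE
    proof (eventually_elim, intro impI)
      fix \<omega>
      assume R: "\<omega> \<in> space S \<longrightarrow> (\<forall>r w. 0 \<le> r \<longrightarrow> 0 \<le> w \<longrightarrow> ennreal r \<le> a \<longrightarrow> ennreal w \<le> v \<longrightarrow>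
        \<omega> r = y \<longrightarrow> \<omega> (r + w) = 0 \<longrightarrow> \<omega> \<in> G)"
      assume "\<omega> \<in> {\<omega> \<in> space S. hitting_time y \<omega> \<le> a \<and> hitting_time y \<omega> < \<infinity> \<and>
       path_shift (enn2real (hitting_time y \<omega>)) \<omega> \<in> ?B}"
      then have \<omega>: "\<omega> \<in> space S" "hitting_time y \<omega> \<le> a" "hitting_time y \<omega> < \<infinity>"
        "path_shift (enn2real (hitting_time y \<omega>)) \<omega> \<in> ?B" by auto
      define r where "r = enn2real (hitting_time y \<omega>)"
      define \<omega>' where "\<omega>' = path_shift r \<omega>"
      define w where "w = enn2real (hitting_time 0 \<omega>')"
      have \<omega>': "\<omega>' \<in> space S" "hitting_time 0 \<omega>' \<le> v" "hitting_time 0 \<omega>' < \<infinity>"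
        using \<omega>(4) by (auto simp: \<omega>'_def r_def)
      have "\<omega> r = y" "\<omega>' w = 0"
        unfolding r_def w_def using \<omega> \<omega>' by (auto intro!: hitting_time_attained continuous_on_path_space)
      moreover have "0 \<le> r" "0 \<le> w" by (auto simp: r_def w_def)
      moreover have "ennreal r \<le> a" "ennreal w \<le> v" using \<omega> \<omega>' by (auto simp: r_def w_def)
      moreover have "\<omega>' w = \<omega> (r + w)" using \<open>0 \<le> w\<close> by (simp add: \<omega>'_def path_shift_def)
      ultimately show "\<omega> \<in> G" using R \<omega>(1) by simp
    qed
  qed
  finally show ?thesis .
qed

lemma finite_hitting: "hitting_time y \<omega> \<le> ennreal u \<and> hitting_time y \<omega> < \<infinity> \<longleftrightarrow> hitting_time y \<omega> \<le> ennreal u"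
  by (auto intro: order_le_less_trans)

lemma hit_zero_chain:
  assumes x: "0 \<le> x" and y: "0 \<le> y" and u: "0 \<le> u" "0 \<le> v"
    and 1: "0 < emeasure (X x) {\<omega> \<in> space S. hitting_time y \<omega> \<le> ennreal u}"
    and 2: "0 < emeasure (X y) {\<omega> \<in> space S. hitting_time 0 \<omega> \<le> ennreal v}"
  shows "0 < emeasure (X x) {\<omega> \<in> space S. hitting_time 0 \<omega> \<le> ennreal (u + v)}"
proof -
  let ?G = "{\<omega> \<in> space S. hitting_time 0 \<omega> \<le> ennreal (u + v)}"
  have "emeasure (X y) {\<omega> \<in> space S. hitting_time 0 \<omega> \<le> ennreal v \<and> hitting_time 0 \<omega> < \<infinity>} *
    emeasure (X x) {\<omega> \<in> space S. hitting_time y \<omega> \<le> ennreal u \<and> hitting_time y \<omega> < \<infinity>} \<le> emeasure (X x) ?G"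
  proof (rule hit_chain[OF x y], measurable, rule AE_I2, intro impI allI)
    fix \<omega> r w
    assume *: "\<omega> \<in> space S" "0 \<le> r" "0 \<le> w" "ennreal r \<le> ennreal u" "ennreal w \<le> ennreal v" "\<omega> (r + w) = 0"
    then have "r + w \<in> {0..u + v}" using u by (simp add: ennreal_le_iff add_mono)
    with * show "\<omega> \<in> ?G"
      using hitting_time_le_iff[OF continuous_on_path_space[OF *(1)], of "u + v" 0] u by auto
  qed
  moreover have "0 < emeasure (X y) {\<omega> \<in> space S. hitting_time 0 \<omega> \<le> ennreal v} *
    emeasure (X x) {\<omega> \<in> space S. hitting_time y \<omega> \<le> ennreal u}"
    using 1 2 by (simp add: ennreal_zero_less_mult_iff)
  ultimately show ?thesis unfolding finite_hitting by (rule order_less_le_trans[rotated])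
qed

text \<open>Equidistant points on the scale: each downward step has probability one half
  to come first, and its mean duration is the step times the distance; the distances telescope.\<close>
lemma hit_zero_pos:
  assumes x: "0 < x" and t: "0 < t"
  shows "0 < emeasure (X x) {\<omega> \<in> space S. hitting_time 0 \<omega> \<le> ennreal t}"
proof -
  define L where "L = s x"
  have L: "0 < L" using bes_scale_strict_mono[OF \<beta>_pos, of 0 x] x by (simp add: L_def)
  define c where "c = sqrt (2 * \<beta>) / 8"
  have c: "0 < c" using \<beta>_pos by (simp add: c_def)
  \<comment> \<open>By linear growth the scale is at least \<open>2 * L\<close> at \<open>B\<close>,
    so \<open>[0, B]\<close> contains a point for every level up to \<open>2 * L\<close>. The levels
    beyond \<open>L\<close> serve the upper neighbour of the last point.\<close>
  define B where "B = 2 * L / c"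
  have B: "0 \<le> B" "2 * L \<le> s B"
    using bes_scale_diff_ge[OF \<beta>_pos, of 0 B] L c by (auto simp: B_def c_def[symmetric])
  have "\<exists>p. p \<in> {0..B} \<and> s p = q" if "0 \<le> q" "q \<le> 2 * L" for q
    using IVT'[of s 0 q B] continuous_on_bes_scale[OF \<beta>_pos, of B] B that by auto
  then obtain g where g: "\<And>q. 0 \<le> q \<Longrightarrow> q \<le> 2 * L \<Longrightarrow> g q \<in> {0..B} \<and> s (g q) = q"
    by metis
  \<comment> \<open>Chosen for the final estimate: the durations sum to at most
    \<open>3 * (L / n) * speed_bound * (2 * B)\<close>.\<close>
  obtain n0 :: nat where "6 * speed_bound * L * B / t < real n0" using reals_Archimedean2 by blast
  define n where "n = Suc n0"
  have n: "6 * speed_bound * L * B / t \<le> real n" "1 \<le> n"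
    using \<open>_ < real n0\<close> by (auto simp: n_def)
  define p where "p k = g (real k * L / real n)" for k
  have q: "0 \<le> real k * L / real n" "real k * L / real n \<le> 2 * L" if "k \<le> n + 1" for k
  proof -
    have "real k \<le> 2 * real n" using that n by simp
    then show "real k * L / real n \<le> 2 * L" using L n by (simp add: field_simps mult_right_mono)
  qed (use L in auto)
  have p: "p k \<in> {0..B}" "s (p k) = real k * L / real n" if "k \<le> n + 1" for k
    using g[OF q[OF that]] by (auto simp: p_def)
  have p_less: "p i < p j" if "i < j" "j \<le> n + 1" for i j
  proof (rule ccontr)
    assume "\<not> p i < p j"
    then have "s (p j) \<le> s (p i)" by (intro monoD[OF mono_s]) auto
    moreover have "s (p i) < s (p j)" using that L n p(2)[of i] p(2)[of j] by (simp add: divide_strict_right_mono)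
    ultimately show False by simp
  qed
  \<comment> \<open>\<open>g\<close> is an arbitrary choice of preimages; injectivity identifies the
    end points \<open>p 0 = 0\<close> and \<open>p n = x\<close>.\<close>
  have inj: "u = v" if "0 \<le> u" "0 \<le> v" "s u = s v" for u v
    using bes_scale_strict_mono[OF \<beta>_pos, of u v] bes_scale_strict_mono[OF \<beta>_pos, of v u] that
    by (cases u v rule: linorder_cases) auto
  have p0: "p 0 = 0" using inj[of "p 0" 0] p[of 0] by auto
  have pn: "p n = x" using inj[of "p n" x] p[of n] n x by (auto simp: L_def)
  \<comment> \<open>The probability one half of the downward exit asks for more than twice the mean
    bound; 3 makes the inequality strict.\<close>
  define \<theta> where "\<theta> k = 3 * (L / real n) * speed_bound * (p (k + 2) - p k)" for k
  have \<theta>0: "0 \<le> \<theta> k" if "k < n" for k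
    using p_less[of k "k + 2"] that L speed_bound_pos by (auto simp: \<theta>_def)
  have step: "0 < emeasure (X (p (Suc k))) {\<omega> \<in> space S. hitting_time (p k) \<omega> \<le> ennreal (\<theta> k)}" if k: "k < n" for k
  proof (rule hit_lower_pos[where b="p (k + 2)"])
    show "0 \<le> p k" using p(1)[of k] k by auto
    show less: "p k < p (Suc k)" "p (Suc k) < p (k + 2)" using k by (auto intro!: p_less)
    show "0 \<le> \<theta> k" using \<theta>0 k by blast
    have d1: "s (p (Suc k)) - s (p k) = L / real n"
      using p(2)[of k] p(2)[of "Suc k"] k n by (simp add: field_simps)
    have d2: "s (p (k + 2)) - s (p k) = 2 * (L / real n)"
      using p(2)[of k] p(2)[of "k + 2"] k n by (simp add: field_simps)
    have "0 < L / real n * speed_bound * (p (k + 2) - p k)"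
      using L n speed_bound_pos less by simp
    moreover have "L / real n / (2 * (L / real n)) = 1 / 2" using L n by simp
    ultimately show "(s (p (Suc k)) - s (p k)) * speed_bound * (p (k + 2) - p k) <
        \<theta> k * (1 - (s (p (Suc k)) - s (p k)) / (s (p (k + 2)) - s (p k)))"
      unfolding d1 d2 \<theta>_def by simp
  qed
  have "0 < emeasure (X (p k)) {\<omega> \<in> space S. hitting_time 0 \<omega> \<le> ennreal (\<Sum>i<k. \<theta> i)}" if "k \<le> n" for k
    using that
  proof (induction k)
    case 0
    interpret prob_space "X 0" by (rule prob_space_X) simp
    have "AE \<omega> in X 0. \<omega> \<in> {\<omega> \<in> space S. hitting_time 0 \<omega> \<le> ennreal 0}"
      using AE_start[OF order_refl] AE_space
    proof eventually_elim
      fix \<omega> assume "\<omega> 0 = 0" "\<omega> \<in> space (X 0)"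
      then show "\<omega> \<in> {\<omega> \<in> space S. hitting_time 0 \<omega> \<le> ennreal 0}"
        using hitting_time_le_iff[OF continuous_on_path_space, of \<omega> "{0..}" 0 0] by (simp add: space_X)
    qed
    moreover have "{\<omega> \<in> space S. hitting_time 0 \<omega> \<le> ennreal 0} \<in> sets (X 0)"
      unfolding sets_X[OF order_refl] by measurable
    ultimately have "emeasure (X 0) {\<omega> \<in> space S. hitting_time 0 \<omega> \<le> ennreal 0} = 1"
      by (simp add: emeasure_eq_1_AE)
    then show ?case by (simp add: p0)
  next
    case (Suc k)
    then have "0 < emeasure (X (p (Suc k))) {\<omega> \<in> space S. hitting_time 0 \<omega> \<le> ennreal (\<theta> k + (\<Sum>i<k. \<theta> i))}"
      using p(1)[of k] p(1)[of "Suc k"] step[of k] \<theta>0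
      by (intro hit_zero_chain[where y="p k"]) (auto intro!: sum_nonneg)
    then show ?case by (simp add: add.commute)
  qed
  from this[of n] have "0 < emeasure (X x) {\<omega> \<in> space S. hitting_time 0 \<omega> \<le> ennreal (\<Sum>i<n. \<theta> i)}"
    by (simp add: pn)
  also have "\<dots> \<le> emeasure (X x) {\<omega> \<in> space S. hitting_time 0 \<omega> \<le> ennreal t}"
  proof (rule emeasure_mono)
    \<comment> \<open>Consecutive exit intervals overlap, so the distances cover
      \<open>[0, B]\<close> at most twice: the source of \<open>2 * B\<close>.\<close>
    have tele: "(\<Sum>i<m. p (i + 2) - p i) = p (m + 1) - p 1 + p m - p 0" for m
      by (induction m) (auto simp: numeral_2_eq_2)
    have "(\<Sum>i<n. \<theta> i) = 3 * (L / real n) * speed_bound * (p (n + 1) - p 1 + p n - p 0)"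
      unfolding \<theta>_def sum_distrib_left[symmetric] tele ..
    also have "\<dots> \<le> 3 * (L / real n) * speed_bound * (2 * B)"
      using p(1)[of "n + 1"] p(1)[of 1] p(1)[of n] p0 L speed_bound_pos n by (intro mult_left_mono) auto
    also have "\<dots> \<le> t"
      using n t by (simp add: field_simps)
    finally show "{\<omega> \<in> space S. hitting_time 0 \<omega> \<le> ennreal (\<Sum>i<n. \<theta> i)} \<subseteq> {\<omega> \<in> space S. hitting_time 0 \<omega> \<le> ennreal t}"
      by (auto intro: order_trans ennreal_leI)
    show "{\<omega> \<in> space S. hitting_time 0 \<omega> \<le> ennreal t} \<in> sets (X x)"
      using x by (subst sets_X) auto
  qed
  finally show ?thesis .
qed

text \<open>The exit time from \<open>(0, b)\<close> has finite mean, so a path that avoids 0 must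
  hit every \<open>b > x\<close> first. This has probability \<open>s x / s b\<close>, which
  vanishes as \<open>b\<close> grows.\<close>

lemma hit_zero_almost_surely:
  assumes x: "0 < x"
  shows "emeasure (X x) {\<omega> \<in> space S. hitting_time 0 \<omega> < \<infinity>} = 1"
proof -
  interpret prob_space "X x" using x by (intro prob_space_X) auto
  have [measurable]: "hitting_time y \<in> borel_measurable (X x)" for y
    using x by (intro measurable_hitting_time_X) auto
  have sp: "space S = space (X x)" using x by (intro space_X[symmetric]) auto
  define D where "D = {\<omega> \<in> space (X x). \<not> hitting_time 0 \<omega> < \<infinity>}"
  have Dm: "D \<in> sets (X x)" unfolding D_def by measurable
  have D: "measure (X x) D * s b \<le> s x" if b: "x < b" for b
  proof -
    have sb: "0 < s b" using bes_scale_strict_mono[OF \<beta>_pos, of 0 b] b x by simp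
    have "(\<integral>\<^sup>+\<omega>. min (hitting_time 0 \<omega>) (hitting_time b \<omega>) \<partial>X x) \<noteq> \<infinity>"
      using mean_exit_time_le[of 0 x b] b x by (auto simp: top_unique)
    then have "AE \<omega> in X x. min (hitting_time 0 \<omega>) (hitting_time b \<omega>) \<noteq> \<infinity>"
      by (intro nn_integral_PInf_AE) measurable
    then have "measure (X x) D \<le> measure (X x) {\<omega> \<in> space S. hitting_time b \<omega> < hitting_time 0 \<omega>}"
      unfolding sp D_def
      by (intro finite_measure_mono_AE) (auto simp: min_def not_less top_unique less_top elim!: eventually_mono split: if_splits)
    also have "\<dots> = s x / s b" using exit_prob[of 0 x b] x b by simp
    finally show ?thesis using sb by (simp add: pos_le_divide_eq)
  qed
  define c where "c = sqrt (2 * \<beta>) / 8"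
  have c: "0 < c" using \<beta>_pos by (simp add: c_def)
  have "measure (X x) D = 0"
  proof (rule ccontr)
    assume "measure (X x) D \<noteq> 0"
    then have m: "0 < measure (X x) D" using measure_nonneg[of "X x" D] by linarith
    \<comment> \<open>Large enough that \<open>s b \<ge> c * b\<close> pushes
      \<open>measure (X x) D * s b\<close> to at least \<open>s x + 1\<close>.\<close>
    define b where "b = max (x + 1) ((s x + 1) / (measure (X x) D * c))"
    have b: "x < b" by (simp add: b_def)
    have "s x + 1 = measure (X x) D * (c * ((s x + 1) / (measure (X x) D * c)))" using m c by simp
    also have "\<dots> \<le> measure (X x) D * (c * b)" using m c by (intro mult_left_mono) (auto simp: b_def)
    also have "\<dots> \<le> measure (X x) D * s b"
      using bes_scale_diff_ge[OF \<beta>_pos, of 0 b] b x m by (intro mult_left_mono) (auto simp: c_def)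
    also have "\<dots> \<le> s x" using b by (rule D)
    finally show False by simp
  qed
  then have "AE \<omega> in X x. \<omega> \<notin> D" using Dm by (simp add: AE_iff_null_sets[symmetric] null_sets_def emeasure_eq_measure)
  then have "AE \<omega> in X x. \<omega> \<in> {\<omega> \<in> space S. hitting_time 0 \<omega> < \<infinity>}"
    using AE_space by eventually_elim (auto simp: D_def sp)
  moreover have "{\<omega> \<in> space S. hitting_time 0 \<omega> < \<infinity>} \<in> sets (X x)" unfolding sp by measurable
  ultimately show ?thesis by (simp add: emeasure_eq_1_AE)
qed

text \<open>The mean hitting time of a small level is below \<open>t\<close>, which is impossible if
  that level is almost surely not hit by time \<open>t\<close>.\<close>

lemma leave_zero_pos:
  assumes t: "0 < t"
  obtains b where "0 < b" "0 < emeasure (X 0) {\<omega> \<in> space S. hitting_time b \<omega> \<le> ennreal t}"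
proof -
  \<comment> \<open>The cap 1 gives \<open>s b \<le> s 1\<close>, so the mean bound becomes linear
    in \<open>b\<close>.\<close>
  define b where "b = min 1 (t / (2 * (s 1 * speed_bound)))"
  have s1: "0 < s 1" using bes_scale_strict_mono[OF \<beta>_pos, of 0 1] by simp
  have b: "0 < b" "b \<le> 1" using s1 t speed_bound_pos by (auto simp: b_def)
  have "s b * speed_bound * b \<le> s 1 * speed_bound * b"
    using b speed_bound_pos by (intro mult_right_mono monoD[OF mono_s]) auto
  also have "\<dots> \<le> s 1 * speed_bound * (t / (2 * (s 1 * speed_bound)))"
    using s1 speed_bound_pos by (intro mult_left_mono) (auto simp: b_def)
  also have "\<dots> = t / 2" using s1 speed_bound_pos by simp
  finally have le: "s b * speed_bound * b \<le> t / 2" .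
  interpret prob_space "X 0" by (intro prob_space_X) auto
  have [measurable]: "hitting_time y \<in> borel_measurable (X 0)" for y
    by (intro measurable_hitting_time_X) auto
  have sp: "space S = space (X 0)" by (intro space_X[symmetric]) auto
  have "emeasure (X 0) {\<omega> \<in> space S. hitting_time b \<omega> \<le> ennreal t} \<noteq> 0"
  proof
    assume z: "emeasure (X 0) {\<omega> \<in> space S. hitting_time b \<omega> \<le> ennreal t} = 0"
    have "{\<omega> \<in> space S. hitting_time b \<omega> \<le> ennreal t} \<in> sets (X 0)" unfolding sp by measurable
    then have AE: "AE \<omega> in X 0. ennreal t < hitting_time b \<omega>"
      using z by (intro AE_I[of _ _ "{\<omega> \<in> space S. hitting_time b \<omega> \<le> ennreal t}"]) (auto simp: sp not_less)
    have "ennreal t = (\<integral>\<^sup>+\<omega>. ennreal t \<partial>X 0)" by (simp add: emeasure_space_1)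
    also have "\<dots> \<le> (\<integral>\<^sup>+\<omega>. hitting_time b \<omega> \<partial>X 0)"
      using AE by (intro nn_integral_mono_AE, eventually_elim) auto
    also have "\<dots> \<le> ennreal (s b * speed_bound * b)" using b(1) by (rule mean_hitting_time_from_0_le)
    also have "\<dots> \<le> ennreal (t / 2)" using le by (rule ennreal_leI)
    finally show False using t by (simp add: ennreal_le_iff)
  qed
  then show ?thesis using that[of b] b by (simp add: zero_less_iff_neq_zero)
qed

lemma leave_zero_almost_surely:
  assumes b: "0 < b"
  shows "emeasure (X 0) {\<omega> \<in> space S. hitting_time b \<omega> < \<infinity>} = 1"
proof -
  interpret prob_space "X 0" by (intro prob_space_X) auto
  have [measurable]: "hitting_time y \<in> borel_measurable (X 0)" for y
    by (intro measurable_hitting_time_X) auto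
  have sp: "space S = space (X 0)" by (intro space_X[symmetric]) auto
  have "(\<integral>\<^sup>+\<omega>. hitting_time b \<omega> \<partial>X 0) \<noteq> \<infinity>"
    using mean_hitting_time_from_0_le[OF b] by (auto simp: top_unique)
  then have "AE \<omega> in X 0. hitting_time b \<omega> \<noteq> \<infinity>"
    by (intro nn_integral_PInf_AE) measurable
  then have "AE \<omega> in X 0. \<omega> \<in> {\<omega> \<in> space S. hitting_time b \<omega> < \<infinity>}"
    using AE_space by eventually_elim (auto simp: sp less_top)
  moreover have "{\<omega> \<in> space S. hitting_time b \<omega> < \<infinity>} \<in> sets (X 0)" unfolding sp by measurable
  ultimately show ?thesis by (simp add: emeasure_eq_1_AE)
qed

lemma sets_hits_within_S: "hits_within t (space S) 0 \<in> sets S"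
  by (rule sets_hits_within) auto

text \<open>A positive visiting time has to be ensured. From \<open>x \<noteq> 0\<close> no path is
  at 0 initially; from 0, the path first reaches some \<open>b > 0\<close>, which takes positive
  time, and then returns, each within \<open>t / 2\<close>.\<close>

lemma hits_within_pos:
  assumes x: "0 \<le> x" and t: "0 < t"
  shows "0 < emeasure (X x) (hits_within (ereal t) (space S) 0)"
proof (cases "x = 0")
  case False
  then have "0 < emeasure (X x) {\<omega> \<in> space S. hitting_time 0 \<omega> \<le> ennreal t}"
    using x t by (intro hit_zero_pos) auto
  also have "\<dots> \<le> emeasure (X x) (hits_within (ereal t) (space S) 0)"
  proof (rule emeasure_mono_AE)
    show "AE \<omega> in X x. \<omega> \<in> {\<omega> \<in> space S. hitting_time 0 \<omega> \<le> ennreal t} \<longrightarrow> \<omega> \<in> hits_within (ereal t) (space S) 0"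
      using AE_start[OF x]
    proof (eventually_elim, intro impI)
      fix \<omega> assume *: "\<omega> 0 = x" "\<omega> \<in> {\<omega> \<in> space S. hitting_time 0 \<omega> \<le> ennreal t}"
      then obtain r where r: "r \<in> {0..t}" "\<omega> r = 0"
        using hitting_time_le_iff[OF continuous_on_path_space, of \<omega> "{0..}" t 0] t by auto
      then have "r \<noteq> 0" using * False by auto
      with r * show "\<omega> \<in> hits_within (ereal t) (space S) 0" by (auto simp: hits_within_def intro!: exI[of _ r])
    qed
    show "hits_within (ereal t) (space S) 0 \<in> sets (X x)" using sets_hits_within_S x by (simp add: sets_X)
  qed
  finally show ?thesis .
next
  case True
  obtain b where b: "0 < b" "0 < emeasure (X 0) {\<omega> \<in> space S. hitting_time b \<omega> \<le> ennreal (t / 2)}"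
    using leave_zero_pos[of "t / 2"] t by auto
  have "0 < emeasure (X b) {\<omega> \<in> space S. hitting_time 0 \<omega> \<le> ennreal (t / 2)} *
      emeasure (X 0) {\<omega> \<in> space S. hitting_time b \<omega> \<le> ennreal (t / 2)}"
    using b hit_zero_pos[of b "t / 2"] t by (simp add: ennreal_zero_less_mult_iff)
  also have "\<dots> = emeasure (X b) {\<omega> \<in> space S. hitting_time 0 \<omega> \<le> ennreal (t / 2) \<and> hitting_time 0 \<omega> < \<infinity>} *
      emeasure (X 0) {\<omega> \<in> space S. hitting_time b \<omega> \<le> ennreal (t / 2) \<and> hitting_time b \<omega> < \<infinity>}"
    unfolding finite_hitting ..
  also have "\<dots> \<le> emeasure (X 0) (hits_within (ereal t) (space S) 0)"
  proof (rule hit_chain[OF order_refl _ sets_hits_within_S])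
    show "AE \<omega> in X 0. \<omega> \<in> space S \<longrightarrow> (\<forall>r w. 0 \<le> r \<longrightarrow> 0 \<le> w \<longrightarrow> ennreal r \<le> ennreal (t / 2) \<longrightarrow>
      ennreal w \<le> ennreal (t / 2) \<longrightarrow> \<omega> r = b \<longrightarrow> \<omega> (r + w) = 0 \<longrightarrow> \<omega> \<in> hits_within (ereal t) (space S) 0)"
      using AE_start[OF order_refl]
    proof (eventually_elim, intro impI allI)
      fix \<omega> r w
      assume *: "\<omega> 0 = 0" "\<omega> \<in> space S" "0 \<le> r" "0 \<le> w" "ennreal r \<le> ennreal (t / 2)"
        "ennreal w \<le> ennreal (t / 2)" "\<omega> r = b" "\<omega> (r + w) = 0"
      then have "r \<le> t / 2" "w \<le> t / 2" "r \<noteq> 0" using t b(1) by (auto simp: ennreal_le_iff)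
      with * show "\<omega> \<in> hits_within (ereal t) (space S) 0"
        unfolding hits_within_def by (auto intro!: exI[of _ "r + w"])
    qed
  qed (use b in auto)
  finally show ?thesis using True by simp
qed

lemma hits_within_almost_surely:
  assumes x: "0 \<le> x"
  shows "emeasure (X x) (hits_within \<infinity> (space S) 0) = 1"
proof -
  interpret prob_space "X x" using x by (intro prob_space_X) auto
  have "1 \<le> emeasure (X x) (hits_within \<infinity> (space S) 0)"
  proof (cases "x = 0")
    case False
    then have "1 = emeasure (X x) {\<omega> \<in> space S. hitting_time 0 \<omega> < \<infinity>}"
      using x by (intro hit_zero_almost_surely[symmetric]) auto
    also have "\<dots> \<le> emeasure (X x) (hits_within \<infinity> (space S) 0)"
    proof (rule emeasure_mono_AE)
      show "AE \<omega> in X x. \<omega> \<in> {\<omega> \<in> space S. hitting_time 0 \<omega> < \<infinity>} \<longrightarrow> \<omega> \<in> hits_within \<infinity> (space S) 0"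
        using AE_start[OF x]
      proof (eventually_elim, intro impI)
        fix \<omega> assume *: "\<omega> 0 = x" "\<omega> \<in> {\<omega> \<in> space S. hitting_time 0 \<omega> < \<infinity>}"
        define r where "r = enn2real (hitting_time 0 \<omega>)"
        have r: "\<omega> r = 0" "0 \<le> r"
          unfolding r_def using * by (auto intro!: hitting_time_attained continuous_on_path_space)
        then have "r \<noteq> 0" using * False by auto
        with r * show "\<omega> \<in> hits_within \<infinity> (space S) 0" by (auto simp: hits_within_def intro!: exI[of _ r])
      qed
      show "hits_within \<infinity> (space S) 0 \<in> sets (X x)" using sets_hits_within_S x by (simp add: sets_X)
    qed
    finally show ?thesis .
  next
    case True
    \<comment> \<open>Without a time limit any positive level can serve as the intermediate point;
      here it is 1.\<close>
    have "1 = emeasure (X 1) {\<omega> \<in> space S. hitting_time 0 \<omega> \<le> \<infinity> \<and> hitting_time 0 \<omega> < \<infinity>} *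
        emeasure (X 0) {\<omega> \<in> space S. hitting_time 1 \<omega> \<le> \<infinity> \<and> hitting_time 1 \<omega> < \<infinity>}"
      using hit_zero_almost_surely[of 1] leave_zero_almost_surely[of 1] by simp
    also have "\<dots> \<le> emeasure (X 0) (hits_within \<infinity> (space S) 0)"
    proof (rule hit_chain[OF order_refl _ sets_hits_within_S])
      show "AE \<omega> in X 0. \<omega> \<in> space S \<longrightarrow> (\<forall>r w. 0 \<le> r \<longrightarrow> 0 \<le> w \<longrightarrow> ennreal r \<le> \<infinity> \<longrightarrow>
        ennreal w \<le> \<infinity> \<longrightarrow> \<omega> r = 1 \<longrightarrow> \<omega> (r + w) = 0 \<longrightarrow> \<omega> \<in> hits_within \<infinity> (space S) 0)"
        using AE_start[OF order_refl]
      proof (eventually_elim, intro impI allI)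
        fix \<omega> r w
        assume *: "\<omega> 0 = 0" "\<omega> \<in> space S" "0 \<le> r" "0 \<le> w" "\<omega> r = 1" "\<omega> (r + w) = 0"
        then have "r \<noteq> 0" by auto
        with * show "\<omega> \<in> hits_within \<infinity> (space S) 0"
          unfolding hits_within_def by (auto intro!: exI[of _ "r + w"])
      qed
    qed auto
    finally show ?thesis using True by simp
  qed
  then show ?thesis using emeasure_le_1 by (intro antisym) auto
qed

end

section \<open>Singularity\<close>

text \<open>The bridge from the plane to the diffusion: a complex number vanishes iff its modulus
  does.\<close>

lemma planar_hits_within:
  fixes \<mu> :: "(real \<Rightarrow> complex) measure"
  assumes "sets \<mu> = sets (path_space {0..} UNIV)"
  shows "emeasure (distr \<mu> (path_space {0..} {0..}) radial) (hits_within t (space (path_space {0..} {0..})) 0) =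
    emeasure \<mu> (hits_within t (space \<mu>) 0)"
proof -
  have sp: "space \<mu> = space (path_space {0..} UNIV)" using assms by (rule sets_eq_imp_space_eq)
  have rad: "radial \<in> \<mu> \<rightarrow>\<^sub>M path_space {0..} {0..}"
    using measurable_radial measurable_cong_sets[OF assms refl] by blast
  have "radial -` hits_within t (space (path_space {0..} {0..})) 0 \<inter> space \<mu> = hits_within t (space \<mu>) 0"
  proof (intro set_eqI iffI)
    fix \<omega> assume "\<omega> \<in> radial -` hits_within t (space (path_space {0..} {0..})) 0 \<inter> space \<mu>"
    then obtain s where s: "\<omega> \<in> space \<mu>" "0 < s" "ereal s \<le> t" "radial \<omega> s = 0"
      by (auto simp: hits_within_def)
    then have "\<omega> s = 0" by (simp add: radial_def)
    then show "\<omega> \<in> hits_within t (space \<mu>) 0" using s by (auto simp: hits_within_def)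
  next
    fix \<omega> assume "\<omega> \<in> hits_within t (space \<mu>) 0"
    then obtain s where s: "\<omega> \<in> space \<mu>" "0 < s" "ereal s \<le> t" "\<omega> s = 0"
      by (auto simp: hits_within_def)
    then have "radial \<omega> s = 0" by (simp add: radial_def)
    then show "\<omega> \<in> radial -` hits_within t (space (path_space {0..} {0..})) 0 \<inter> space \<mu>"
      using s measurable_space[OF rad s(1)] by (auto simp: hits_within_def)
  qed
  moreover have "hits_within t (space (path_space {0..} {0..})) (0::real) \<in> sets (path_space {0..} {0..})"
    by (rule sets_hits_within) auto
  ultimately show ?thesis using emeasure_distr[OF rad] by simp
qed

lemma law_upto_hits_within:
  fixes y :: "'a::metric_space"
  assumes "sets \<mu> = sets (path_space {0..} UNIV)"
  shows "emeasure (law_upto t \<mu>) (hits_within (ereal t) (space (path_space {0..t} UNIV)) y) =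
    emeasure \<mu> (hits_within (ereal t) (space \<mu>) y)"
proof -
  have sp: "space \<mu> = space (path_space {0..} UNIV)" using assms by (rule sets_eq_imp_space_eq)
  have res: "(\<lambda>\<omega>. restrict \<omega> {0..t}) \<in> \<mu> \<rightarrow>\<^sub>M path_space {0..t} UNIV"
    by (subst measurable_cong_sets[OF assms refl]) (rule measurable_restrict_path, auto)
  have "(\<lambda>\<omega>. restrict \<omega> {0..t}) -` hits_within (ereal t) (space (path_space {0..t} UNIV)) y \<inter> space \<mu> =
      hits_within (ereal t) (space \<mu>) y"
    using measurable_space[OF res] by (auto simp: hits_within_def intro!: exI)
  moreover have "hits_within (ereal t) (space (path_space {0..t} UNIV)) y \<in> sets (path_space {0..t} UNIV)"
    by (rule sets_hits_within) auto
  ultimately show ?thesis using emeasure_distr[OF res] by (simp add: law_upto_def)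
qed

theorem proposition2p9:
  fixes \<beta> :: real and z0 :: complex
    and P :: "complex \<Rightarrow> (real \<Rightarrow> complex) measure"
    and W :: "(real \<Rightarrow> complex) measure"
  assumes "0 < \<beta>"
    and "planar_bes_down \<beta> P"
    and "brownian_motion z0 W"
  shows "(\<forall>t1>0. has_nonzero_singular_part (law_upto t1 (P z0)) (law_upto t1 W)) \<and>
         mutually_singular (P z0) W"
proof -
  obtain X where X: "bes_down \<beta> X" "\<And>z. distr (P z) (path_space {0..} {0..}) radial = X (cmod z)"
    using assms(2) by (auto simp: planar_bes_down_def)
  interpret bes_down_diffusion \<beta> X using assms(1) X(1) by unfold_locales
  have sm: "strong_markov_family UNIV P" using assms(2) by (simp add: planar_bes_down_def)
  interpret P: prob_space "P z0" using sm by (rule strong_markov_prob_space) simp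
  have setsP: "sets (P z0) = sets (path_space {0..} UNIV)" using sm by (rule strong_markov_prob_space) simp
  have setsW: "sets W = sets (path_space {0..} UNIV)" using assms(3) by (rule sets_brownian_motion)
  have spP: "space (P z0) = space (path_space {0..} UNIV)" using setsP by (rule sets_eq_imp_space_eq)
  have spW: "space W = space (path_space {0..} UNIV)" using setsW by (rule sets_eq_imp_space_eq)
  have PX: "emeasure (P z0) (hits_within t (space (P z0)) 0) =
      emeasure (X (cmod z0)) (hits_within t (space (path_space {0..} {0..})) 0)" for t
    using planar_hits_within[OF setsP, of t] X(2)[of z0] by simp
  have "has_nonzero_singular_part (law_upto t (P z0)) (law_upto t W)" if t: "0 < t" for t
  proof (rule has_nonzero_singular_partI)
    let ?H = "hits_within (ereal t) (space (path_space {0..t} UNIV)) (0::complex)"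
    have "(\<lambda>\<omega>. restrict \<omega> {0..t}) \<in> P z0 \<rightarrow>\<^sub>M path_space {0..t} UNIV"
      by (subst measurable_cong_sets[OF setsP refl]) (rule measurable_restrict_path, auto)
    then show "finite_measure (law_upto t (P z0))"
      unfolding law_upto_def by (rule P.finite_measure_distr)
    show "sets (law_upto t (P z0)) = sets (law_upto t W)" by (simp add: law_upto_def)
    show "?H \<in> sets (law_upto t W)"
      unfolding law_upto_def sets_distr by (rule sets_hits_within) auto
    show "emeasure (law_upto t W) ?H = 0"
      using planar_brownian_motion_no_hit[OF assms(3)] by (simp add: law_upto_hits_within[OF setsW])
    show "emeasure (law_upto t (P z0)) ?H \<noteq> 0"
      using hits_within_pos[OF norm_ge_zero t, of z0] by (simp add: law_upto_hits_within[OF setsP] PX)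
  qed
  moreover have "mutually_singular (P z0) W"
    unfolding mutually_singular_def
  proof (intro conjI bexI)
    \<comment> \<open>\<open>?H\<close> carries all of \<open>P z0\<close> and is null for
      \<open>W\<close>; since the separating set in \<open>mutually_singular\<close> is null for the
      first measure, the witness is the complement of \<open>?H\<close>.\<close>
    let ?H = "hits_within \<infinity> (space (path_space {0..} UNIV)) (0::complex)"
    have H: "?H \<in> sets (P z0)" unfolding setsP by (rule sets_hits_within) auto
    show "sets (P z0) = sets W" using setsP setsW by simp
    show "space (P z0) - ?H \<in> sets (P z0)" using H by blast
    have "emeasure (P z0) ?H = 1"
      using PX[of \<infinity>] hits_within_almost_surely[OF norm_ge_zero, of z0] by (simp add: spP)
    then show "emeasure (P z0) (space (P z0) - ?H) = 0"
      using H by (simp add: P.emeasure_eq_measure P.prob_compl)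
    have "space W - (space (P z0) - ?H) = ?H" by (auto simp: spP spW hits_within_def)
    then show "emeasure W (space W - (space (P z0) - ?H)) = 0"
      using planar_brownian_motion_no_hit[OF assms(3), of \<infinity>] by (simp add: spW)
  qed
  ultimately show ?thesis by blast
qed

end
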